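(* Let $t_0\in\mathbb{R}$, $a>0$, $J=[t_0,t_0+a]$, let $g:J\to\mathbb{R}$ be nondecreasing and left-continuous, let $x_0\in\mathbb{R}^n$, and let $f,h:J\times\mathbb{R}^n\to\mathbb{R}^n$ be functions satisfying: (A1) For every $u\in\mathbb{R}^n$, the function $f(\cdot,u)$ is Kurzweil--Stieltjes integrable with respect to $g$ on $J$. (A2) There exists a function $M:J\to[0,\infty)$, Kurzweil--Stieltjes integrable with respect to $g$ on $J$, such that $\left\|\int_c^d f(s,u)\,\mathrm{d}g(s)\right\|\le\int_c^d M(s)\,\mathrm{d}g(s)$ for all $u\in\mathbb{R}^n$ and all $[c,d]\subseteq J$. (A3* ) For every $v\in\mathbb{R}^n$, the function $h(\cdot,v)$ is regulated on $J$, and there exists a function $\varphi:[0,\infty)\times[0,\infty)\to[0,\infty)$ such that for every $r\ge0$, $\varphi(\cdot,r)$ is a $\mathfrak{D}$-function satisfying $\varphi(t,r)<t$ for all $t>0$, and $\|h(t,u)-h(t,v)\|\le\varphi(\|u-v\|,r)$ for all $u,v\in\mathbb{R}^n$ with $\|u\|,\|v\|\le r$ and all $t\in J$. Let $x(\cdot)$ be a solution of the problem $$x(t)=x_0-h(t_0,x(t_0))+h(t,x(t))+\int_{t_0}^t f(s,x(s))\,\mathrm{d}g(s),\quad t\in J,\qquad x(t_0)=x_0 .$$ Assume further that $h$ is continuously differentiable, that $I-J_xh(t,x(t))$ is invertible for $t\in J$, and that $f$ and $g$ are continuous functions. Then $x(\cdot)$ satisfies the following properties: (a) The function $x(\cdot)$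 is differentiable for almost every $t\in[t_0,t_0+a]$. (b) For each $t\in[t_0,t_0+a)$ such that the right derivative $g'_+(t)$ exists, the right derivative $x'_+(t)$ also exists. Similarly, for each $t\in(t_0,t_0+a]$ such that the left derivative $g'_-(t)$ exists, the left derivative $x'_-(t)$ also exists. (c) If $g$ is differentiable at $t$, then $x(\cdot)$ is also differentiable at $t$. (d) If $g$ is continuously differentiable at $t$, then $x(\cdot)$ is also continuously differentiable at $t$.
   Context: $\mathbb{R}^n$ carries a norm $\|\cdot\|$; $I$ is the $n\times n$ identity matrix, and $J_xh(t,x)$ is the $n\times n$ Jacobian matrix $\left(\partial h_i/\partial x_j\right)_{i,j}$ of $h=(h_1,\dots,h_n)$ with respect to the variable $x\in\mathbb{R}^n$, evaluated at $(t,x)$. A function $x:[a,b]\to X$ ($X$ a Banach space) is regulated if the one-sided limit $x(t^-)$ exists for every $t\in(a,b]$ and $x(t^+)$ exists for every $t\in[a,b)$. Kurzweil--Stieltjes integral: a gauge on $[a,b]$ is a function $\delta:[a,b]\to(0,\infty)$. A tagged partition $a=s_0\le s_1\le\dots\le s_k=b$ with tags $\tau_i\in[s_{i-1},s_i]$ is $\delta$-fine if $[s_{i-1},s_i]\subset(\tau_i-\delta(\tau_i),\tau_i+\delta(\tau_i))$ for all $i$. A function $f:[a,b]\to\mathbb{R}^n$ is Kurzweil--Stieltjes integrable with respect to $g:[a,b]\to\mathbb{R}$ if there is $\mathcal{I}\in\mathbb{R}^n$ such that for every $\varepsilon>0$ there is a gauge $\delta$ on $[a,b]$ with $\left\|\sum_{i=1}^k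 f(\tau_i)(g(s_i)-g(s_{i-1}))-\mathcal{I}\right\|<\varepsilon$ for all $\delta$-fine tagged partitions of $[a,b]$; then $\int_a^b f\,\mathrm{d}g:=\mathcal{I}$. All integrals are in this sense. A $\mathfrak{D}$-function is a continuous nondecreasing function $\psi:[0,\infty)\to[0,\infty)$ with $\psi(0)=0$ and $\psi(s)>0$ for $s>0$. A solution of the problem is a regulated function $x:J\to\mathbb{R}^n$ such that $t\mapsto h(t,x(t))$ is regulated on $J$, the integral equation holds for all $t\in J$ (with the integral existing in the Kurzweil--Stieltjes sense), and $x(t_0)=x_0$. *)

theory Defs
  imports "HOL-Analysis.Analysis"
begin

definition is_norm :: "('a::real_vector \<Rightarrow> real) \<Rightarrow> bool" where
  "is_norm N \<longleftrightarrow>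
     (\<forall>u. 0 \<le> N u) \<and> (\<forall>u. N u = 0 \<longleftrightarrow> u = 0) \<and>
     (\<forall>c u. N (c *\<^sub>R u) = \<bar>c\<bar> * N u) \<and> (\<forall>u v. N (u + v) \<le> N u + N v)"

text \<open>One-sided limits are taken in the topology of the type; on a finite-dimensional space this is
  the topology of every norm.\<close>

definition regulated_on :: "real \<Rightarrow> real \<Rightarrow> (real \<Rightarrow> 'a::topological_space) \<Rightarrow> bool" where
  "regulated_on a b x \<longleftrightarrow>
     (\<forall>t\<in>{a<..b}. \<exists>l. (x \<longlongrightarrow> l) (at_left t)) \<and> (\<forall>t\<in>{a..<b}. \<exists>l. (x \<longlongrightarrow> l) (at_right t))"

text \<open>The division points are \<open>s 0, \<dots>, s k\<close>; the tag of \<open>[s i, s (i + 1)]\<close> is \<open>\<tau> i\<close>, for \<open>i < k\<close>.\<close>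

definition fine_tagged_partition ::
  "(real \<Rightarrow> real) \<Rightarrow> real \<Rightarrow> real \<Rightarrow> nat \<Rightarrow> (nat \<Rightarrow> real) \<Rightarrow> (nat \<Rightarrow> real) \<Rightarrow> bool" where
  "fine_tagged_partition \<delta> a b k s \<tau> \<longleftrightarrow>
     s 0 = a \<and> s k = b \<and>
     (\<forall>i<k. s i \<le> s (Suc i) \<and> \<tau> i \<in> {s i..s (Suc i)} \<and>
        {s i..s (Suc i)} \<subseteq> {\<tau> i - \<delta> (\<tau> i)<..<\<tau> i + \<delta> (\<tau> i)})"

text \<open>Kurzweil--Stieltjes integral; the norm \<open>N\<close> of the value space of the integrand is explicit
  (\<open>abs\<close> for real-valued integrands).\<close>

definition has_ks_integral ::
  "('a::real_vector \<Rightarrow> real) \<Rightarrow> (real \<Rightarrow> 'a) \<Rightarrow> (real \<Rightarrow> real) \<Rightarrow> real \<Rightarrow> real \<Rightarrow> 'a \<Rightarrow> bool" where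
  "has_ks_integral N f g a b I \<longleftrightarrow>
     (\<forall>\<epsilon>>0. \<exists>\<delta>. (\<forall>t\<in>{a..b}. 0 < \<delta> t) \<and>
        (\<forall>k s \<tau>. fine_tagged_partition \<delta> a b k s \<tau> \<longrightarrow>
           N ((\<Sum>i<k. (g (s (Suc i)) - g (s i)) *\<^sub>R f (\<tau> i)) - I) < \<epsilon>))"

definition ks_integrable ::
  "('a::real_vector \<Rightarrow> real) \<Rightarrow> (real \<Rightarrow> 'a) \<Rightarrow> (real \<Rightarrow> real) \<Rightarrow> real \<Rightarrow> real \<Rightarrow> bool" where
  "ks_integrable N f g a b \<longleftrightarrow> (\<exists>I. has_ks_integral N f g a b I)"

definition ks_integral ::
  "('a::real_vector \<Rightarrow> real) \<Rightarrow> (real \<Rightarrow> 'a) \<Rightarrow> (real \<Rightarrow> real) \<Rightarrow> real \<Rightarrow> real \<Rightarrow> 'a" where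
  "ks_integral N f g a b = (THE I. has_ks_integral N f g a b I)"

definition D_function :: "(real \<Rightarrow> real) \<Rightarrow> bool" where
  "D_function \<psi> \<longleftrightarrow>
     (\<forall>s\<ge>0. 0 \<le> \<psi> s) \<and> continuous_on {0..} \<psi> \<and> mono_on {0..} \<psi> \<and> \<psi> 0 = 0 \<and> (\<forall>s>0. 0 < \<psi> s)"

definition is_solution ::
  "('a::real_normed_vector \<Rightarrow> real) \<Rightarrow> (real \<Rightarrow> 'a \<Rightarrow> 'a) \<Rightarrow> (real \<Rightarrow> 'a \<Rightarrow> 'a) \<Rightarrow> (real \<Rightarrow> real) \<Rightarrow>
   real \<Rightarrow> real \<Rightarrow> 'a \<Rightarrow> (real \<Rightarrow> 'a) \<Rightarrow> bool" where
  "is_solution N f h g t0 a x0 x \<longleftrightarrow>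
     regulated_on t0 (t0 + a) x \<and>
     regulated_on t0 (t0 + a) (\<lambda>t. h t (x t)) \<and>
     (\<forall>t\<in>{t0..t0 + a}.
        ks_integrable N (\<lambda>s. f s (x s)) g t0 t \<and>
        x t = x0 - h t0 (x t0) + h t (x t) + ks_integral N (\<lambda>s. f s (x s)) g t0 t) \<and>
     x t0 = x0"

text \<open>Derivatives are taken within \<open>S\<close>, hence one-sided at the endpoints when \<open>S\<close> is a compact
  interval times a vector space.\<close>

definition continuously_differentiable_on ::
  "('a::real_normed_vector \<Rightarrow> 'b::real_normed_vector) \<Rightarrow> 'a set \<Rightarrow> bool" where
  "continuously_differentiable_on F S \<longleftrightarrow>
     (\<exists>F' :: 'a \<Rightarrow> 'a \<Rightarrow>\<^sub>L 'b.
        (\<forall>p\<in>S. (F has_derivative blinfun_apply (F' p)) (at p within S)) \<and> continuous_on S F')"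

text \<open>Continuous differentiability at a single point: the derivative exists at all points of \<open>S\<close>
  near \<open>t\<close> and is continuous at \<open>t\<close>.\<close>

definition continuously_differentiable_at ::
  "(real \<Rightarrow> 'b::real_normed_vector) \<Rightarrow> real \<Rightarrow> real set \<Rightarrow> bool" where
  "continuously_differentiable_at F t S \<longleftrightarrow>
     (\<exists>F'. \<exists>e>0. (\<forall>s\<in>S \<inter> ball t e. (F has_vector_derivative F' s) (at s within S)) \<and>
        continuous (at t within S) F')"

end

theory Submission
  imports Defs
begin

text \<open>Put \<open>F t = \<integral>\<^bsub>t0\<^esub>\<^bsup>t\<^esup> f(s, x(s)) dg(s)\<close>. The equation says \<open>x t - h(t, x t) = C + F t\<close> with a
constant \<open>C\<close>, and everything follows from comparing increments on both sides.

The increments of \<open>F\<close> are controlled by those of \<open>g\<close>: if the integrand stays within \<open>e\<close> of a vector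
\<open>v\<close> between \<open>s\<close> and \<open>t\<close>, then \<open>F t - F s\<close> is within \<open>e * \<bar>g t - g s\<bar>\<close> of \<open>(g t - g s) v\<close>. This
estimate (\<open>ks_primitive_ks_integral\<close>) carries both the continuity of \<open>F\<close> and its derivative.

Continuity of \<open>x\<close> (\<open>solution_continuous\<close>): since \<open>F\<close> is continuous, a one-sided limit \<open>l\<close> of \<open>x\<close> at
\<open>t\<close> satisfies \<open>l - h(t, l) = x t - h(t, x t)\<close>, and the contraction property of \<open>h\<close> forces
\<open>l = x t\<close>.

Differentiability: once \<open>x\<close> is continuous, the estimate gives \<open>F' = g' f(t, x t)\<close> wherever \<open>g\<close> has
a (possibly one-sided) derivative. Linearising \<open>h\<close> at \<open>(t, x t)\<close>, with derivative \<open>T\<close>, the difference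
quotient \<open>q\<close> of \<open>x\<close> solves \<open>q - T(0, q) = T(1, 0) + F' + o(1 + \<bar>q\<bar>)\<close>. The operator on the left is
\<open>I - J\<^sub>x h\<close>, which is invertible, so \<open>q\<close> stays bounded, the error vanishes, and \<open>q\<close> converges
(\<open>implicit_derivative_within\<close>). The same perturbation lemma, \<open>tendsto_perturbed_linear_equation\<close>, applied to the linear
equation that the derivative of \<open>x\<close> satisfies shows that this derivative is continuous where \<open>g'\<close> is
(\<open>implicit_derivative_continuous\<close>).

The statement on almost every \<open>t\<close> reduces in this way to Lebesgue's theorem that the monotone function
\<open>g\<close> is differentiable almost everywhere. It is proved for continuous \<open>g\<close> from the Vitali covering theorem
(\<open>mono_continuous_negligible_nondifferentiable\<close>).\<close>

section \<open>Differentiability almost everywhere of monotone continuous functions\<close>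

text \<open>All intervals around \<open>t\<close> are admitted, not only those with \<open>t\<close> as an endpoint. The upper and lower
limits of the slopes over such intervals bracket the four Dini derivatives, so that comparing this one pair
of limits settles differentiability.\<close>

definition small_slopes :: "(real \<Rightarrow> bool) \<Rightarrow> (real \<Rightarrow> real) \<Rightarrow> real \<Rightarrow> bool" where
  "small_slopes R G t \<longleftrightarrow>
     (\<forall>d>0. \<exists>u v. u < v \<and> t \<in> {u..v} \<and> v - u < d \<and> R ((G v - G u) / (v - u)))"

lemma Vitali_covering_Icc:
  fixes S :: "real set" and P :: "real \<Rightarrow> real \<Rightarrow> bool"
  assumes "\<And>t d. t \<in> S \<Longrightarrow> 0 < d \<Longrightarrow> \<exists>u v. u < v \<and> t \<in> {u..v} \<and> v - u < d \<and> P u v"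
  obtains C where "countable C" "\<And>u v. (u, v) \<in> C \<Longrightarrow> u < v \<and> P u v"
    "disjoint_family_on (\<lambda>(u, v). {u..v}) C" "negligible (S - (\<Union>(u, v)\<in>C. {u..v}))"
proof -
  define K where "K = {(u, v). u < v \<and> P u v}"
  define c where "c = (\<lambda>(u, v). (u + v) / 2 :: real)"
  define r where "r = (\<lambda>(u, v). (v - u) / 2 :: real)"
  have ball: "cball (c i) (r i) = (case i of (u, v) \<Rightarrow> {u..v})" for i
    by (cases i) (auto simp: c_def r_def cball_eq_atLeastAtMost field_simps)
  have r_pos: "0 < r i" if "i \<in> K" for i
    using that by (auto simp: K_def r_def)
  have fine: "\<exists>i. i \<in> K \<and> t \<in> cball (c i) (r i) \<and> r i < d" if "t \<in> S" "0 < d" for t d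
  proof -
    obtain u v where "u < v" "t \<in> {u..v}" "v - u < d" "P u v"
      using assms[OF \<open>t \<in> S\<close> \<open>0 < d\<close>] by blast
    then show ?thesis
      unfolding ball by (intro exI[of _ "(u, v)"]) (auto simp: K_def r_def)
  qed
  obtain C where C: "countable C" "C \<subseteq> K"
    "pairwise (\<lambda>i j. disjnt (cball (c i) (r i)) (cball (c j) (r j))) C"
    "negligible (S - (\<Union>i\<in>C. cball (c i) (r i)))"
    using Vitali_covering_theorem_cballs[of K r S c, OF r_pos fine] by blast
  show ?thesis
  proof (rule that[of C])
    show "disjoint_family_on (\<lambda>(u, v). {u..v}) C"
      using C(3) unfolding ball disjoint_family_on_def pairwise_def disjnt_def by blast
    show "negligible (S - (\<Union>(u, v)\<in>C. {u..v}))"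
      using C(4) unfolding ball .
  qed (use C in \<open>auto simp: K_def\<close>)
qed

lemma emeasure_UN_le_cmult:
  assumes "countable C" "disjoint_family_on X C" "sets M = sets L"
    and "\<And>i. i \<in> C \<Longrightarrow> X i \<in> sets L"
    and "\<And>i. i \<in> C \<Longrightarrow> emeasure M (X i) \<le> c * emeasure L (X i)"
  shows "emeasure M (\<Union>i\<in>C. X i) \<le> c * emeasure L (\<Union>i\<in>C. X i)"
proof -
  have "emeasure M (\<Union>i\<in>C. X i) = (\<integral>\<^sup>+i. emeasure M (X i) \<partial>count_space C)"
    using assms by (intro emeasure_UN_countable) auto
  also have "\<dots> \<le> (\<integral>\<^sup>+i. c * emeasure L (X i) \<partial>count_space C)"
    using assms(5) by (intro nn_integral_mono) auto
  also have "\<dots> = c * (\<integral>\<^sup>+i. emeasure L (X i) \<partial>count_space C)"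
    by (intro nn_integral_cmult) auto
  also have "\<dots> = c * emeasure L (\<Union>i\<in>C. X i)"
    using assms by (subst emeasure_UN_countable) auto
  finally show ?thesis .
qed

lemma lmeasurable_cover_mod_negligible:
  assumes B: "B \<in> lmeasurable" "measure lebesgue B \<le> c" and neg: "negligible (E - B)"
  shows "\<exists>T\<in>lmeasurable. E \<subseteq> T \<and> measure lebesgue T \<le> c"
proof (intro bexI conjI)
  have "E - B \<in> lmeasurable" "measure lebesgue (E - B) = 0"
    using neg by (simp_all add: negligible_iff_measure)
  then show "B \<union> (E - B) \<in> lmeasurable" "measure lebesgue (B \<union> (E - B)) \<le> c"
    using B measure_Un_le[of B lebesgue "E - B"] fmeasurable.Un[of B lebesgue "E - B"]
    by (auto simp del: Un_Diff_cancel)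
qed auto

context
  fixes G :: "real \<Rightarrow> real"
  assumes mono_G: "mono G" and cont_G: "continuous_on UNIV G"
begin

text \<open>For a continuous nondecreasing function the increment over \<open>[u, v]\<close> is the Stieltjes measure of
\<open>[u, v]\<close>; bounds on slopes therefore become comparisons of the Stieltjes measure with Lebesgue
measure on disjoint unions of intervals.\<close>

lemma emeasure_interval_measure_le:
  assumes C: "countable C" "disjoint_family_on (\<lambda>(u, v). {u..v}) C"
    and less: "\<And>u v. (u, v) \<in> C \<Longrightarrow> u < v"
    and slope: "\<And>u v. (u, v) \<in> C \<Longrightarrow> (G v - G u) / (v - u) \<le> p"
  shows "emeasure (interval_measure G) (\<Union>(u, v)\<in>C. {u..v})
    \<le> ennreal p * emeasure lborel (\<Union>(u, v)\<in>C. {u..v})"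
proof (rule emeasure_UN_le_cmult[OF C])
  fix i assume "i \<in> C"
  then obtain u v where i: "i = (u, v)" "(u, v) \<in> C" by (cases i) auto
  have uv: "u < v" "G v - G u \<le> p * (v - u)" "G u \<le> G v"
    using less[OF i(2)] slope[OF i(2)] mono_G by (auto simp: field_simps mono_def)
  moreover have "0 \<le> p" using uv by (smt (verit) mult_neg_pos)
  ultimately show "emeasure (interval_measure G) (case i of (u, v) \<Rightarrow> {u..v})
      \<le> ennreal p * emeasure lborel (case i of (u, v) \<Rightarrow> {u..v})"
    using mono_G cont_G
    by (simp add: i emeasure_interval_measure_Icc mono_def ennreal_mult[symmetric] ennreal_leI)
qed auto

lemma emeasure_lborel_le:
  assumes C: "countable C" "disjoint_family_on (\<lambda>(u, v). {u..v}) C"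
    and less: "\<And>u v. (u, v) \<in> C \<Longrightarrow> u < v"
    and slope: "\<And>u v. (u, v) \<in> C \<Longrightarrow> q \<le> (G v - G u) / (v - u)" and "0 < q"
  shows "emeasure lborel (\<Union>(u, v)\<in>C. {u..v})
    \<le> ennreal (1 / q) * emeasure (interval_measure G) (\<Union>(u, v)\<in>C. {u..v})"
proof (rule emeasure_UN_le_cmult[OF C])
  fix i assume "i \<in> C"
  then obtain u v where i: "i = (u, v)" "(u, v) \<in> C" by (cases i) auto
  have "u < v" "v - u \<le> 1 / q * (G v - G u)" "G u \<le> G v"
    using less[OF i(2)] slope[OF i(2)] mono_G \<open>0 < q\<close> by (auto simp: field_simps mono_def)
  then show "emeasure lborel (case i of (u, v) \<Rightarrow> {u..v})
      \<le> ennreal (1 / q) * emeasure (interval_measure G) (case i of (u, v) \<Rightarrow> {u..v})"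
    using mono_G cont_G \<open>0 < q\<close> ennreal_leI[of "v - u" "1 / q * (G v - G u)"]
      ennreal_mult[of "1 / q" "G v - G u"]
    by (simp add: i emeasure_interval_measure_Icc mono_def del: times_divide_eq_left)
qed auto

text \<open>Vitali's covering theorem is used twice. Intervals of slope below \<open>p\<close> inside \<open>U\<close> cover almost all of
\<open>E\<close>, so their union has Stieltjes measure at most \<open>p\<close> times the measure of \<open>U\<close>. Inside them,
intervals of slope above \<open>q\<close> again cover almost all of \<open>E\<close>, and their total length is at most
\<open>1 / q\<close> times that Stieltjes measure.\<close>

lemma cover_shrinks:
  assumes E: "\<And>t. t \<in> E \<Longrightarrow> small_slopes (\<lambda>s. s < p) G t"
    "\<And>t. t \<in> E \<Longrightarrow> small_slopes (\<lambda>s. q < s) G t"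
    and pq: "0 < p" "0 < q" and U: "open U" "U \<in> lmeasurable" "E \<subseteq> U"
  shows "\<exists>T\<in>lmeasurable. E \<subseteq> T \<and> measure lebesgue T \<le> p / q * measure lebesgue U"
proof -
  have E1: "\<exists>u v. u < v \<and> t \<in> {u..v} \<and> v - u < d \<and> ({u..v} \<subseteq> U \<and> (G v - G u) / (v - u) < p)"
    if t: "t \<in> E" "0 < d" for t d
  proof -
    obtain e where e: "0 < e" "ball t e \<subseteq> U"
      using U t open_contains_ball by (metis subsetD)
    then obtain u v where uv: "u < v" "t \<in> {u..v}" "v - u < min d e" "(G v - G u) / (v - u) < p"
      using E(1)[OF t(1)] t(2) unfolding small_slopes_def by (metis min_less_iff_conj)
    then have "{u..v} \<subseteq> ball t e" by (auto simp: dist_real_def)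
    then show ?thesis using uv e by (intro exI[of _ u] exI[of _ v]) auto
  qed
  obtain C where C: "countable C" 
     "\<And>u v. (u, v) \<in> C \<Longrightarrow> u < v \<and> ({u..v} \<subseteq> U \<and> (G v - G u) / (v - u) < p)"
    "disjoint_family_on (\<lambda>(u, v). {u..v}) C" "negligible (E - (\<Union>(u, v)\<in>C. {u..v}))"
    using Vitali_covering_Icc[OF E1] by blast
  \<comment> \<open>The second family has to lie inside an open set; dropping the endpoints of the first family loses only countably many points.\<close>
  define V where "V = (\<Union>(u, v)\<in>C. {u<..<v})"
  have V: "open V" "V \<subseteq> (\<Union>(u, v)\<in>C. {u..v})" by (auto simp: V_def)
  have "E - V \<subseteq> (E - (\<Union>(u, v)\<in>C. {u..v})) \<union> (fst ` C \<union> snd ` C)"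
    by (force simp: V_def)
  then have "E - V \<subseteq> (E - (\<Union>(u, v)\<in>C. {u..v})) \<union> (\<Union>x\<in>fst ` C \<union> snd ` C. {x})"
    by simp
  moreover have "negligible (\<Union>x\<in>fst ` C \<union> snd ` C. {x})"
    using C(1) by (intro negligible_countable_Union) auto
  ultimately have EV: "negligible (E - V)"
    by (rule negligible_subset[OF negligible_Un[OF C(4)], rotated])
  have E2: "\<exists>u v. u < v \<and> t \<in> {u..v} \<and> v - u < d \<and> ({u..v} \<subseteq> V \<and> q < (G v - G u) / (v - u))"
    if t: "t \<in> E \<inter> V" "0 < d" for t d
  proof -
    obtain e where e: "0 < e" "ball t e \<subseteq> V"
      using V(1) t open_contains_ball by (metis IntD2)
    then obtain u v where uv: "u < v" "t \<in> {u..v}" "v - u < min d e" "q < (G v - G u) / (v - u)"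
      using E(2) t unfolding small_slopes_def by (metis min_less_iff_conj IntD1)
    then have "{u..v} \<subseteq> ball t e" by (auto simp: dist_real_def)
    then show ?thesis using uv e by (intro exI[of _ u] exI[of _ v]) auto
  qed
  obtain D where D: "countable D" 
     "\<And>u v. (u, v) \<in> D \<Longrightarrow> u < v \<and> ({u..v} \<subseteq> V \<and> q < (G v - G u) / (v - u))"
    "disjoint_family_on (\<lambda>(u, v). {u..v}) D" "negligible (E \<inter> V - (\<Union>(u, v)\<in>D. {u..v}))"
    using Vitali_covering_Icc[OF E2] by blast
  define A where "A = (\<Union>(u, v)\<in>C. {u..v})"
  define B where "B = (\<Union>(u, v)\<in>D. {u..v})"
  have sets: "A \<in> sets borel" "B \<in> sets borel"
    using C(1) D(1) unfolding A_def B_def by (auto intro!: sets.countable_UN')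
  have sub: "B \<subseteq> A" "A \<subseteq> U"
    using C(2) D(2) V unfolding A_def B_def by blast+
  have "emeasure lborel B \<le> ennreal (1 / q) * emeasure (interval_measure G) B"
    unfolding B_def using D pq less_imp_le by (intro emeasure_lborel_le) blast+
  also have "\<dots> \<le> ennreal (1 / q) * emeasure (interval_measure G) A"
    using sub sets by (intro mult_left_mono emeasure_mono) auto
  also have "\<dots> \<le> ennreal (1 / q) * (ennreal p * emeasure lborel A)"
    unfolding A_def using C by (intro mult_left_mono emeasure_interval_measure_le) (auto intro: less_imp_le)
  also have "\<dots> \<le> ennreal (1 / q) * (ennreal p * emeasure lborel U)"
    using sub U by (intro mult_left_mono emeasure_mono) auto
  also have "emeasure lborel U = ennreal (measure lebesgue U)"
    using U emeasure_eq_measure2[OF U(2)] by simp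
  also have "ennreal (1 / q) * (ennreal p * ennreal (measure lebesgue U)) = ennreal (p / q * measure lebesgue U)"
    using pq by (simp add: ennreal_mult[symmetric])
  finally have le: "emeasure lebesgue B \<le> ennreal (p / q * measure lebesgue U)"
    using sets by simp
  have neg: "negligible (E - B)"
    using negligible_subset[OF negligible_Un[OF EV D(4)], of "E - B"] by (auto simp: B_def)
  have B: "B \<in> lmeasurable"
    using sets U(2) sub lmeasurable_iff_integrable fmeasurableI2[of U lebesgue B] by auto
  then have "measure lebesgue B \<le> p / q * measure lebesgue U"
    using le pq by (simp add: emeasure_eq_measure2)
  then show ?thesis using lmeasurable_cover_mod_negligible[OF B _ neg] by blast
qed

text \<open>By the previous lemma the outer measure \<open>m\<close> of the exceptional set satisfies \<open>m \<le> (p / q) m\<close>,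
hence \<open>m = 0\<close>.\<close>

lemma negligible_oscillating_slopes:
  assumes "0 < p" "p < q"
  shows "negligible {t\<in>{\<alpha>..\<beta>}. small_slopes (\<lambda>s. s < p) G t \<and> small_slopes (\<lambda>s. q < s) G t}"
    (is "negligible ?E")
proof -
  define \<T> where "\<T> = {T \<in> lmeasurable. ?E \<subseteq> T}"
  define m where "m = Inf (measure lebesgue ` \<T>)"
  have "{\<alpha>..\<beta>} \<in> \<T>" by (auto simp: \<T>_def)
  then have ne: "\<T> \<noteq> {}" by blast
  have m_le: "m \<le> measure lebesgue T" if "T \<in> \<T>" for T
    unfolding m_def using that by (intro cInf_lower bdd_belowI[of _ 0]) auto
  have "0 \<le> m" unfolding m_def using ne by (intro cInf_greatest) auto
  have "q / p * m \<le> measure lebesgue T" if T: "T \<in> \<T>" for T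
  proof (rule field_le_epsilon)
    fix e :: real assume "0 < e"
    have T': "T \<in> lmeasurable" "?E \<subseteq> T" using T by (auto simp: \<T>_def)
    obtain U where U: "open U" "T \<subseteq> U" "U - T \<in> lmeasurable" "emeasure lebesgue (U - T) < ennreal e"
      using sets_lebesgue_outer_open[OF fmeasurableD[OF T'(1)] \<open>0 < e\<close>] by blast
    have TU: "T \<union> (U - T) = U" using U by auto
    have Um: "U \<in> lmeasurable" "measure lebesgue U \<le> measure lebesgue T + measure lebesgue (U - T)"
      using measure_Un_le[OF fmeasurableD[OF T'(1)] fmeasurableD[OF U(3)]] fmeasurable.Un[OF T'(1) U(3)]
      unfolding TU by auto
    have "measure lebesgue (U - T) \<le> e"
      using U(3,4) \<open>0 < e\<close> by (simp add: emeasure_eq_measure2 ennreal_less_iff)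
    moreover have "\<exists>T\<in>lmeasurable. ?E \<subseteq> T \<and> measure lebesgue T \<le> p / q * measure lebesgue U"
    proof (rule cover_shrinks)
      show "?E \<subseteq> U" using T'(2) U(2) by (rule order_trans)
    qed (use assms U(1) Um(1) in auto)
    then obtain T2 where "T2 \<in> \<T>" "measure lebesgue T2 \<le> p / q * measure lebesgue U"
      unfolding \<T>_def by blast
    then have "m \<le> p / q * measure lebesgue U" using m_le[of T2] by linarith
    then have "q / p * m \<le> measure lebesgue U" using assms by (simp add: field_simps)
    ultimately show "q / p * m \<le> measure lebesgue T + e" using Um by linarith
  qed
  then have "q / p * m \<le> m" unfolding m_def using ne by (intro cInf_greatest) auto
  then have "q * m \<le> p * m" using assms by (simp add: field_simps)
  then have "m \<le> 0" using assms by (simp add: mult_le_cancel_right)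
  show ?thesis
    unfolding negligible_outer
  proof (intro allI impI)
    fix e :: real assume "0 < e"
    with \<open>m \<le> 0\<close> have "Inf (measure lebesgue ` \<T>) < e" unfolding m_def by simp
    then obtain T where "T \<in> \<T>" "measure lebesgue T < e"
      using cInf_lessD[of "measure lebesgue ` \<T>"] ne by auto
    then show "\<exists>T. ?E \<subseteq> T \<and> T \<in> lmeasurable \<and> measure lebesgue T < e"
      by (auto simp: \<T>_def)
  qed
qed

text \<open>Disjoint intervals of slope above \<open>q\<close> have total length at most \<open>1 / q\<close> times the total increment
of \<open>G\<close>, which is finite on a bounded set; \<open>q\<close> is arbitrary.\<close>

lemma negligible_infinite_slopes:
  "negligible {t\<in>{\<alpha>..\<beta>}. \<forall>q>0. small_slopes (\<lambda>s. q < s) G t}" (is "negligible ?Z")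
  unfolding negligible_outer_le
proof (intro allI impI)
  fix e :: real assume "0 < e"
  \<comment> \<open>The \<open>+ 1\<close> only ensures that \<open>k\<close> is positive; the covering intervals may stick out of \<open>[\<alpha>, \<beta>]\<close> by at most \<open>1\<close>.\<close>
  define k where "k = \<bar>G (\<beta> + 1) - G (\<alpha> - 1)\<bar> + 1"
  define q where "q = k / e"
  have k: "k > 0" unfolding k_def by linarith
  have q: "q > 0" using k \<open>0 < e\<close> by (simp add: q_def)
  have fine: "\<exists>u v. u < v \<and> t \<in> {u..v} \<and> v - u < d \<and> ({u..v} \<subseteq> {\<alpha>-1..\<beta>+1} \<and> q < (G v - G u) / (v - u))"
    if t: "t \<in> ?Z" "0 < d" for t d
  proof -
    have "small_slopes (\<lambda>s. q < s) G t" using t q by auto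
    then obtain u v where uv: "u < v" "t \<in> {u..v}" "v - u < min d 1" "q < (G v - G u) / (v - u)"
      using \<open>0 < d\<close> unfolding small_slopes_def by (metis min_less_iff_conj zero_less_one)
    then show ?thesis using t by (intro exI[of _ u] exI[of _ v]) auto
  qed
  obtain D where D: "countable D" 
     "\<And>u v. (u, v) \<in> D \<Longrightarrow> u < v \<and> ({u..v} \<subseteq> {\<alpha>-1..\<beta>+1} \<and> q < (G v - G u) / (v - u))"
    "disjoint_family_on (\<lambda>(u, v). {u..v}) D" "negligible (?Z - (\<Union>(u, v)\<in>D. {u..v}))"
    using Vitali_covering_Icc[OF fine] by blast
  define B where "B = (\<Union>(u, v)\<in>D. {u..v})"
  have sets: "B \<in> sets borel"
    using D(1) unfolding B_def by (auto intro!: sets.countable_UN')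
  have sub: "B \<subseteq> {\<alpha>-1..\<beta>+1}" using D(2) unfolding B_def by blast
  have "emeasure lborel B \<le> ennreal (1 / q) * emeasure (interval_measure G) B"
    unfolding B_def using D q less_imp_le by (intro emeasure_lborel_le) blast+
  also have "\<dots> \<le> ennreal (1 / q) * emeasure (interval_measure G) {\<alpha>-1..\<beta>+1}"
    using sub by (intro mult_left_mono emeasure_mono) auto
  also have "\<dots> \<le> ennreal (1 / q) * ennreal k"
    using mono_G cont_G
    by (cases "\<alpha> - 1 \<le> \<beta> + 1")
       (auto simp: emeasure_interval_measure_Icc mono_def k_def intro!: mult_left_mono ennreal_leI)
  also have "\<dots> = ennreal e" using \<open>0 < e\<close> k by (simp add: ennreal_mult[symmetric] q_def)
  finally have le: "emeasure lebesgue B \<le> ennreal e" using sets by simp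
  have B: "B \<in> lmeasurable"
    using sets sub fmeasurableI2[of "{\<alpha>-1..\<beta>+1}" lebesgue B] by auto
  then have "measure lebesgue B \<le> e"
    using le \<open>0 < e\<close> by (simp add: emeasure_eq_measure2)
  moreover have "negligible (?Z - B)" using D(4) by (simp add: B_def)
  ultimately show "\<exists>T. ?Z \<subseteq> T \<and> T \<in> lmeasurable \<and> measure lebesgue T \<le> e"
    using lmeasurable_cover_mod_negligible[OF B] by blast
qed

text \<open>The derivative is the upper limit \<open>L\<close> of the slopes. If the slopes fell below \<open>L - e\<close> on arbitrarily
small intervals, then two rationals between \<open>L - e\<close> and \<open>L\<close> would separate such slopes from those
close to \<open>L\<close>.\<close>

lemma differentiable_if_slopes_converge:
  assumes fin: "\<not> (\<forall>q>0. small_slopes (\<lambda>s. q < s) G t)"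
    and osc: "\<And>p q. p \<in> \<rat> \<Longrightarrow> q \<in> \<rat> \<Longrightarrow> 0 < p \<Longrightarrow> p < q \<Longrightarrow>
      \<not> (small_slopes (\<lambda>s. s < p) G t \<and> small_slopes (\<lambda>s. q < s) G t)"
  shows "G differentiable (at t)"
proof -
  define S where "S = {c. \<not> small_slopes (\<lambda>s. c < s) G t}"
  define L where "L = Inf S"
  have slope_nonneg: "0 \<le> (G v - G u) / (v - u)" if "u < v" for u v
    using that mono_G by (auto simp: mono_def)
  have ne: "S \<noteq> {}" using fin by (auto simp: S_def)
  have "0 \<le> c" if "c \<in> S" for c
  proof (rule ccontr)
    assume c: "\<not> 0 \<le> c"
    have "small_slopes (\<lambda>s. c < s) G t"
      unfolding small_slopes_def
    proof (intro allI impI)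
      fix d :: real assume "0 < d"
      then show "\<exists>u v. u < v \<and> t \<in> {u..v} \<and> v - u < d \<and> c < (G v - G u) / (v - u)"
        using c slope_nonneg[of t "t + d/2"] by (intro exI[of _ t] exI[of _ "t + d/2"]) auto
    qed
    then show False using that by (simp add: S_def)
  qed
  then have bdd: "bdd_below S" by (intro bdd_belowI[of _ 0])
  have upper: "\<not> small_slopes (\<lambda>s. L + e < s) G t" if "0 < e" for e
  proof -
    have "Inf S < L + e" using that by (simp add: L_def)
    then obtain c where "c \<in> S" "c < L + e" using cInf_lessD[OF ne] by blast
    then show ?thesis unfolding S_def small_slopes_def by simp (meson less_trans)
  qed
  have lower: "\<not> small_slopes (\<lambda>s. s < L - e) G t" if "0 < e" for e
  proof
    assume sl: "small_slopes (\<lambda>s. s < L - e) G t"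
    then obtain u v where "u < v" "(G v - G u) / (v - u) < L - e"
      unfolding small_slopes_def by (metis zero_less_one)
    then have "0 < L - e" using slope_nonneg[of u v] by linarith
    have "L - e < L" using that by simp
    then obtain p where p: "p \<in> \<rat>" "L - e < p" "p < L" using Rats_dense_in_real by blast
    obtain q where q: "q \<in> \<rat>" "p < q" "q < L" using Rats_dense_in_real[OF p(3)] by blast
    have "small_slopes (\<lambda>s. s < p) G t"
      using sl p(2) unfolding small_slopes_def by (meson less_trans)
    moreover have "0 < p" using p(2) \<open>0 < L - e\<close> by linarith
    ultimately have "q \<in> S" using osc[OF p(1) q(1)] q(2) unfolding S_def by blast
    then have "L \<le> q" unfolding L_def using bdd by (rule cInf_lower)
    then show False using q(3) by linarith
  qed
  have "(G has_field_derivative L) (at t)"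
    unfolding has_field_derivative_iff tendsto_iff
  proof (intro allI impI)
    fix e :: real assume "0 < e"
    then have e2: "0 < e / 2" by simp
    obtain d1 where d1: "0 < d1"
      "\<And>u v. u < v \<Longrightarrow> t \<in> {u..v} \<Longrightarrow> v - u < d1 \<Longrightarrow> (G v - G u) / (v - u) \<le> L + e / 2"
      using upper[OF e2] unfolding small_slopes_def by (meson not_less)
    obtain d2 where d2: "0 < d2"
      "\<And>u v. u < v \<Longrightarrow> t \<in> {u..v} \<Longrightarrow> v - u < d2 \<Longrightarrow> L - e / 2 \<le> (G v - G u) / (v - u)"
      using lower[OF e2] unfolding small_slopes_def by (meson not_less)
    have "dist ((G y - G t) / (y - t)) L < e" if y: "y \<noteq> t" "dist y t < min d1 d2" for y
    proof -
      define u v where "u = min y t" and "v = max y t"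
      have "(G y - G t) / (y - t) = (G v - G u) / (v - u)"
        using y by (auto simp: u_def v_def min_def max_def field_simps)
      moreover have "u < v" "t \<in> {u..v}" "v - u < d1" "v - u < d2"
        using y by (auto simp: u_def v_def dist_real_def)
      ultimately show ?thesis
        using d1(2)[of u v] d2(2)[of u v] \<open>0 < e\<close> unfolding dist_real_def by linarith
    qed
    then show "\<forall>\<^sub>F y in at t. dist ((G y - G t) / (y - t)) L < e"
      unfolding eventually_at using d1(1) d2(1) by (intro exI[of _ "min d1 d2"]) auto
  qed
  then show ?thesis by (auto simp: real_differentiable_def)
qed

theorem mono_continuous_negligible_nondifferentiable: "negligible {t. \<not> G differentiable (at t)}"
proof -
  define E where "E n p q = {t\<in>{- real n..real n}. small_slopes (\<lambda>s. s < p) G t \<and> small_slopes (\<lambda>s. q < s) G t}" for n p q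
  define Z where "Z n = {t\<in>{- real n..real n}. \<forall>q>0. small_slopes (\<lambda>s. q < s) G t}" for n
  define R where "R = {(p, q). p \<in> \<rat> \<and> q \<in> \<rat> \<and> 0 < p \<and> p < (q::real)}"
  have "R \<subseteq> \<rat> \<times> \<rat>" by (auto simp: R_def)
  then have R: "countable R" using countable_subset countable_SIGMA countable_rat by metis
  have "negligible (\<Union>n. Z n \<union> (\<Union>(p, q)\<in>R. E n p q))"
  proof (intro negligible_countable_Union countable_image negligible_Un)
    fix X assume "X \<in> range (\<lambda>n. Z n \<union> (\<Union>(p, q)\<in>R. E n p q))"
    then obtain n where X: "X = Z n \<union> (\<Union>(p, q)\<in>R. E n p q)" by auto
    have "negligible (E n p q)" if "(p, q) \<in> R" for p q
      unfolding E_def using that by (intro negligible_oscillating_slopes) (auto simp: R_def)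
    then have "negligible (\<Union>(p, q)\<in>R. E n p q)"
      using R by (intro negligible_countable_Union) auto
    then show "negligible X"
      unfolding X Z_def by (intro negligible_Un negligible_infinite_slopes)
  qed auto
  moreover have "{t. \<not> G differentiable (at t)} \<subseteq> (\<Union>n. Z n \<union> (\<Union>(p, q)\<in>R. E n p q))"
  proof clarify
    fix t assume nd: "\<not> G differentiable (at t)" 
    obtain n where "\<bar>t\<bar> \<le> real n" using real_arch_simple by blast
    then have "t \<in> {- real n..real n}" by auto
    then have "t \<in> Z n \<union> (\<Union>(p, q)\<in>R. E n p q)"
      using nd differentiable_if_slopes_converge[of t] by (auto simp: Z_def E_def R_def)
    then show "t \<in> (\<Union>n. Z n \<union> (\<Union>(p, q)\<in>R. E n p q))" by blast
  qed
  ultimately show ?thesis by (rule negligible_subset)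
qed

end

text \<open>Extending \<open>g\<close> by constants beyond the endpoints makes it monotone and continuous on the whole line.\<close>

lemma mono_on_Icc_negligible_nondifferentiable:
  fixes g :: "real \<Rightarrow> real"
  assumes ab: "a \<le> b" and mono: "mono_on {a..b} g" and cont: "continuous_on {a..b} g"
  shows "negligible {t\<in>{a..b}. \<not> g differentiable (at t within {a..b})}"
proof -
  define G where "G t = g (max a (min b t))" for t
  have "mono G"
    unfolding G_def by (intro monoI mono_onD[OF mono]) (use ab in auto)
  moreover have "continuous_on UNIV G"
    unfolding G_def by (intro continuous_on_compose2[OF cont] continuous_intros) (use ab in auto)
  ultimately have "negligible {t. \<not> G differentiable (at t)}" by (rule mono_continuous_negligible_nondifferentiable)
  moreover have "g differentiable (at t within {a..b})" if t: "t \<in> {a..b}" "G differentiable (at t)" for t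
  proof -
    have "G differentiable (at t within {a..b})" using t(2) by (rule differentiable_at_withinI)
    then show ?thesis
      by (rule differentiable_transform_within[OF _ zero_less_one t(1)]) (auto simp: G_def min_def max_def)
  qed
  ultimately show ?thesis by (elim negligible_subset) blast
qed

section \<open>Kurzweil--Stieltjes integrals\<close>

lemma fine_tagged_partition_tags:
  assumes "fine_tagged_partition \<delta> a b k s \<tau>" "i < k"
  shows "\<tau> i \<in> {a..b}" "s i \<le> s (Suc i)" "s i \<in> {a..b}" "s (Suc i) \<in> {a..b}"
proof -
  have step: "s j \<le> s (Suc j)" if "j < k" for j
    using assms(1) that by (auto simp: fine_tagged_partition_def)
  have lower: "s 0 \<le> s j" if "j \<le> k" for j
    using that
  proof (induction j)
    case (Suc j)
    then show ?case using step[of j] by simp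
  qed simp
  have upper: "s j \<le> s k" if "j \<le> k" for j
    using that
  proof (induction rule: inc_induct)
    case (step j)
    then show ?case using \<open>\<And>j. j < k \<Longrightarrow> s j \<le> s (Suc j)\<close>[of j] by simp
  qed simp
  have "a \<le> s i" "s (Suc i) \<le> b" "s i \<le> \<tau> i" "\<tau> i \<le> s (Suc i)"
    using assms lower[of i] upper[of "Suc i"] by (auto simp: fine_tagged_partition_def)
  then show "\<tau> i \<in> {a..b}" "s i \<le> s (Suc i)" "s i \<in> {a..b}" "s (Suc i) \<in> {a..b}" by auto
qed

definition ks_sum :: "(real \<Rightarrow> 'a::real_vector) \<Rightarrow> (real \<Rightarrow> real) \<Rightarrow> nat \<Rightarrow> (nat \<Rightarrow> real) \<Rightarrow> (nat \<Rightarrow> real) \<Rightarrow> 'a" where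
  "ks_sum f g k s \<tau> = (\<Sum>i<k. (g (s (Suc i)) - g (s i)) *\<^sub>R f (\<tau> i))"

text \<open>The sum is carried along because the integral over an initial interval has to be compared with the integral
over a longer one.\<close>

lemma fine_tagged_partition_append:
  fixes f :: "real \<Rightarrow> 'a::real_vector"
  assumes 1: "fine_tagged_partition \<delta> a b k s \<tau>" and 2: "fine_tagged_partition \<delta> b c l s' \<tau>'"
  obtains s'' \<tau>'' where "fine_tagged_partition \<delta> a c (k + l) s'' \<tau>''"
    "ks_sum f g (k + l) s'' \<tau>'' = ks_sum f g k s \<tau> + ks_sum f g l s' \<tau>'"
proof -
  define s'' where "s'' i = (if i < k then s i else s' (i - k))" for i
  define \<tau>'' where "\<tau>'' i = (if i < k then \<tau> i else \<tau>' (i - k))" for i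
  have eq: "s k = s' 0" using 1 2 by (simp add: fine_tagged_partition_def)
  have left: "s'' i = s i" "s'' (Suc i) = s (Suc i)" "\<tau>'' i = \<tau> i" if "i < k" for i
    using that eq by (cases "Suc i = k"; auto simp: s''_def \<tau>''_def)+
  have right: "s'' (k + i) = s' i" "s'' (Suc (k + i)) = s' (Suc i)" "\<tau>'' (k + i) = \<tau>' i" for i
    by (auto simp: s''_def \<tau>''_def Suc_diff_le)
  show ?thesis
  proof (rule that)
    have "s'' i \<le> s'' (Suc i) \<and> \<tau>'' i \<in> {s'' i..s'' (Suc i)} \<and>
        {s'' i..s'' (Suc i)} \<subseteq> {\<tau>'' i - \<delta> (\<tau>'' i)<..<\<tau>'' i + \<delta> (\<tau>'' i)}" if "i < k + l" for i
    proof (cases "i < k")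
      case True
      show ?thesis unfolding left[OF True] using 1 True by (simp add: fine_tagged_partition_def)
    next
      case False
      then have j: "i = k + (i - k)" "i - k < l" using that by auto
      show ?thesis
        using 2 j(2) right[of "i - k"] unfolding j(1)[symmetric] by (simp add: fine_tagged_partition_def)
    qed
    moreover have "s'' 0 = a" "s'' (k + l) = c"
      using 1 2 right(1)[of l] by (auto simp: s''_def fine_tagged_partition_def)
    ultimately show "fine_tagged_partition \<delta> a c (k + l) s'' \<tau>''"
      by (simp add: fine_tagged_partition_def)
    have split: "(\<Sum>i<k + l. u i) = (\<Sum>i<k. u i) + (\<Sum>i<l. u (k + i))" for u :: "nat \<Rightarrow> 'a"
      by (induction l) (auto simp: add.assoc)
    show "ks_sum f g (k + l) s'' \<tau>'' = ks_sum f g k s \<tau> + ks_sum f g l s' \<tau>'"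
      unfolding ks_sum_def split by (simp add: left right)
  qed
qed

lemma Cousin:
  assumes "a \<le> b" and "\<And>t. t \<in> {a..b} \<Longrightarrow> 0 < \<delta> t"
  obtains k s \<tau> where "fine_tagged_partition \<delta> a b k s \<tau>"
proof -
  define P where "P c d \<longleftrightarrow> (\<exists>k s \<tau>. fine_tagged_partition \<delta> c d k s \<tau>)" for c d
  have "P a b"
    using \<open>a \<le> b\<close>
  proof (rule Bolzano)
    fix c d e assume "P c d" "P d e"
    then show "P c e" unfolding P_def by (meson fine_tagged_partition_append)
  next
    fix x assume "a \<le> x" "x \<le> b"
    then have "0 < \<delta> x" using assms(2) by auto
    moreover have "P c d" if "c \<le> x \<and> x \<le> d \<and> d - c < \<delta> x" for c d
      unfolding P_def fine_tagged_partition_def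
      by (intro exI[of _ "Suc 0"] exI[of _ "\<lambda>i. if i = 0 then c else d"] exI[of _ "\<lambda>_. x"])
        (use that in auto)
    ultimately show "\<exists>d>0. \<forall>a b. a \<le> x \<and> x \<le> b \<and> b - a < d \<longrightarrow> P a b" by blast
  qed
  then show ?thesis using that unfolding P_def by blast
qed

lemma ks_sum_close:
  fixes f :: "real \<Rightarrow> 'a::real_normed_vector"
  assumes fine: "fine_tagged_partition \<delta> c d k s \<tau>" and g: "mono_on {c..d} g"
    and close: "\<And>t. t \<in> {c..d} \<Longrightarrow> norm (f t - v) \<le> e"
  shows "norm (ks_sum f g k s \<tau> - (g d - g c) *\<^sub>R v) \<le> e * (g d - g c)"
proof -
  have ends: "s 0 = c" "s k = d" using fine by (auto simp: fine_tagged_partition_def)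
  have tele: "(\<Sum>i<k. g (s (Suc i)) - g (s i)) = g d - g c"
    using sum_lessThan_telescope[of "\<lambda>i. g (s i)" k] by (simp add: ends)
  have "ks_sum f g k s \<tau> - (g d - g c) *\<^sub>R v = (\<Sum>i<k. (g (s (Suc i)) - g (s i)) *\<^sub>R (f (\<tau> i) - v))"
    unfolding ks_sum_def tele[symmetric] scaleR_sum_left sum_subtractf[symmetric] scaleR_diff_right ..
  also have "norm \<dots> \<le> (\<Sum>i<k. (g (s (Suc i)) - g (s i)) * e)"
  proof (rule sum_norm_le)
    fix i assume "i \<in> {..<k}"
    then have "0 \<le> g (s (Suc i)) - g (s i)" "norm (f (\<tau> i) - v) \<le> e"
      using fine_tagged_partition_tags[OF fine, of i] g close by (auto simp: mono_on_def)
    then show "norm ((g (s (Suc i)) - g (s i)) *\<^sub>R (f (\<tau> i) - v)) \<le> (g (s (Suc i)) - g (s i)) * e"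
      by (simp add: mult_left_mono)
  qed
  also have "\<dots> = e * (g d - g c)"
    unfolding sum_distrib_right[symmetric] tele by simp
  finally show ?thesis .
qed

lemma has_ks_integralE:
  assumes "has_ks_integral N f g a b I" "0 < e"
  obtains \<delta> where "\<And>t. t \<in> {a..b} \<Longrightarrow> 0 < \<delta> t"
    "\<And>k s \<tau>. fine_tagged_partition \<delta> a b k s \<tau> \<Longrightarrow> N (ks_sum f g k s \<tau> - I) < e"
proof -
  obtain \<delta> where "(\<forall>t\<in>{a..b}. 0 < \<delta> t) \<and>
      (\<forall>k s \<tau>. fine_tagged_partition \<delta> a b k s \<tau> \<longrightarrow> N (ks_sum f g k s \<tau> - I) < e)"
    using assms unfolding has_ks_integral_def ks_sum_def by blast
  then show ?thesis by (intro that[of \<delta>]) blast+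
qed

text \<open>The difference of the integrals over \<open>[a, d]\<close> and \<open>[a, c]\<close> is approximated by a Riemann sum over
\<open>[c, d]\<close>: a fine partition of \<open>[a, c]\<close> is continued by one of \<open>[c, d]\<close>. For such a sum the
estimate is the triangle inequality.\<close>

lemma has_ks_integral_increment:
  fixes f :: "real \<Rightarrow> 'a::real_normed_vector"
  assumes I: "has_ks_integral norm f g a c I" and I': "has_ks_integral norm f g a d I'"
    and acd: "a \<le> c" "c \<le> d" and g: "mono_on {c..d} g"
    and close: "\<And>t. t \<in> {c..d} \<Longrightarrow> norm (f t - v) \<le> e"
  shows "norm (I' - I - (g d - g c) *\<^sub>R v) \<le> e * (g d - g c)"
proof (rule field_le_epsilon)
  fix \<eta> :: real assume "0 < \<eta>"
  then have \<eta>2: "0 < \<eta> / 2" by simp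
  obtain \<delta> where \<delta>: "\<And>t. t \<in> {a..c} \<Longrightarrow> 0 < \<delta> t"
    "\<And>k s \<tau>. fine_tagged_partition \<delta> a c k s \<tau> \<Longrightarrow> norm (ks_sum f g k s \<tau> - I) < \<eta> / 2"
    using has_ks_integralE[OF I \<eta>2] by blast
  obtain \<delta>' where \<delta>': "\<And>t. t \<in> {a..d} \<Longrightarrow> 0 < \<delta>' t"
    "\<And>k s \<tau>. fine_tagged_partition \<delta>' a d k s \<tau> \<Longrightarrow> norm (ks_sum f g k s \<tau> - I') < \<eta> / 2"
    using has_ks_integralE[OF I' \<eta>2] by blast
  \<comment> \<open>Positivity of \<open>\<delta>\<close> is known on \<open>[a, c]\<close> only, so the two gauges are combined there and \<open>\<delta>'\<close> alone is used on \<open>[c, d]\<close>.\<close>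
  obtain k s \<tau> where p: "fine_tagged_partition (\<lambda>t. min (\<delta> t) (\<delta>' t)) a c k s \<tau>"
    by (rule Cousin[of a c "\<lambda>t. min (\<delta> t) (\<delta>' t)"]) (use acd \<delta>(1) \<delta>'(1) in auto)
  then have p1: "fine_tagged_partition \<delta> a c k s \<tau>" and p2: "fine_tagged_partition \<delta>' a c k s \<tau>"
    by (fastforce simp: fine_tagged_partition_def)+
  obtain l s' \<tau>' where q: "fine_tagged_partition \<delta>' c d l s' \<tau>'"
    by (rule Cousin[of c d \<delta>']) (use acd \<delta>'(1) in auto)
  obtain s'' \<tau>'' where r: "fine_tagged_partition \<delta>' a d (k + l) s'' \<tau>''"
    "ks_sum f g (k + l) s'' \<tau>'' = ks_sum f g k s \<tau> + ks_sum f g l s' \<tau>'"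
    by (rule fine_tagged_partition_append[OF p2 q])
  let ?A = "ks_sum f g k s \<tau>" and ?B = "ks_sum f g l s' \<tau>'" and ?v = "(g d - g c) *\<^sub>R v"
  have eq: "I' - I - ?v = (?A - I) - (?A + ?B - I') + (?B - ?v)" by simp
  have "norm (I' - I - ?v) \<le> norm (?A - I) + norm (?A + ?B - I') + norm (?B - ?v)"
    unfolding eq by (rule order_trans[OF norm_triangle_ineq add_right_mono[OF norm_triangle_ineq4]])
  also have "\<dots> \<le> \<eta> / 2 + \<eta> / 2 + e * (g d - g c)"
    using \<delta>(2)[OF p1] \<delta>'(2)[OF r(1)] ks_sum_close[OF q g close] unfolding r(2) by (intro add_mono) auto
  finally show "norm (I' - I - ?v) \<le> e * (g d - g c) + \<eta>" by simp
qed

text \<open>For \<open>c = d\<close> the increment estimate reads \<open>norm (I' - I) \<le> 0\<close>.\<close>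

corollary has_ks_integral_unique:
  fixes f :: "real \<Rightarrow> 'a::real_normed_vector"
  assumes "has_ks_integral norm f g a b I" "has_ks_integral norm f g a b I'" "a \<le> b"
  shows "I' = I"
  using has_ks_integral_increment[OF assms(1,2), of "f b" 0] assms(3)
  by (auto simp: mono_on_def)

text \<open>A norm on a finite-dimensional space is continuous, hence attains a positive minimum on the Euclidean unit
sphere.\<close>

lemma is_norm_bound:
  fixes N :: "'a::euclidean_space \<Rightarrow> real"
  assumes N: "is_norm N"
  obtains C where "0 < C" "\<And>u. norm u \<le> C * N u"
proof -
  have scale: "N (c *\<^sub>R u) = \<bar>c\<bar> * N u" and add: "N (u + v) \<le> N u + N v"
    and nonneg: "0 \<le> N u" and zero: "N u = 0 \<longleftrightarrow> u = 0" for c u v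
    using N by (auto simp: is_norm_def)
  define K where "K = (\<Sum>b\<in>Basis. N b)"
  have sum: "N (\<Sum>b\<in>B. u b) \<le> (\<Sum>b\<in>B. N (u b))" if "finite B" for B and u :: "'a \<Rightarrow> 'a"
    using that
  proof (induction rule: finite_induct)
    case empty
    show ?case using zero[of 0] by simp
  next
    case (insert b B)
    show ?case using add[of "u b" "\<Sum>b\<in>B. u b"] insert by simp
  qed
  have upper: "N u \<le> K * norm u" for u
  proof -
    have "N u = N (\<Sum>b\<in>Basis. (u \<bullet> b) *\<^sub>R b)" by (simp add: euclidean_representation)
    also have "\<dots> \<le> (\<Sum>b\<in>Basis. \<bar>u \<bullet> b\<bar> * N b)" using sum[OF finite_Basis, of "\<lambda>b. (u \<bullet> b) *\<^sub>R b"] by (simp add: scale)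
    also have "\<dots> \<le> (\<Sum>b\<in>Basis. N b * norm u)"
      using nonneg by (intro sum_mono) (simp add: mult.commute mult_left_mono Basis_le_norm)
    finally show ?thesis by (simp add: K_def sum_distrib_right)
  qed
  have "continuous_on UNIV N"
  proof (rule lipschitz_on_continuous_on)
    have "\<bar>N u - N v\<bar> \<le> K * dist u v" for u v
      using add[of "u - v" v] add[of "v - u" u] upper[of "u - v"] upper[of "v - u"]
      by (simp add: dist_norm norm_minus_commute abs_le_iff)
    moreover have "0 \<le> K" unfolding K_def using nonneg by (simp add: sum_nonneg)
    ultimately show "K-lipschitz_on UNIV N" by (auto simp: lipschitz_on_def dist_real_def)
  qed
  then have "continuous_on (sphere (0::'a) 1) N" using continuous_on_subset by blast
  moreover have "sphere (0::'a) 1 \<noteq> {}" by simp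
  ultimately obtain w where w: "norm w = 1" "\<And>u. norm u = 1 \<Longrightarrow> N w \<le> N u"
    using continuous_attains_inf[OF compact_sphere, of "0::'a" 1 N] by auto
  have pos: "0 < N w" using w(1) nonneg[of w] zero[of w] by fastforce
  have "norm u \<le> 1 / N w * N u" for u
  proof (cases "u = 0")
    case False
    then have "N w \<le> N u / norm u" using w(2)[of "(1 / norm u) *\<^sub>R u"] by (simp add: scale)
    then show ?thesis using False pos by (simp add: field_simps)
  next
    case True
    then show ?thesis using zero[of 0] by simp
  qed
  then show ?thesis using that pos by (metis zero_less_divide_1_iff)
qed

lemma has_ks_integral_norm:
  fixes f :: "real \<Rightarrow> 'a::euclidean_space"
  assumes N: "is_norm N" and I: "has_ks_integral N f g a b I"
  shows "has_ks_integral norm f g a b I"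
proof -
  obtain C where C: "0 < C" "\<And>u. norm u \<le> C * N u" using is_norm_bound[OF N] by blast
  show ?thesis
    unfolding has_ks_integral_def
  proof (intro allI impI)
    fix e :: real assume "0 < e"
    then have "0 < e / C" using C by simp
    then obtain \<delta> where \<delta>: "\<And>t. t \<in> {a..b} \<Longrightarrow> 0 < \<delta> t"
      "\<And>k s \<tau>. fine_tagged_partition \<delta> a b k s \<tau> \<Longrightarrow> N (ks_sum f g k s \<tau> - I) < e / C"
      using has_ks_integralE[OF I] by blast
    have "norm u < e" if "N u < e / C" for u
      using C(1) C(2)[of u] that by (simp add: field_simps)
    then show "\<exists>\<delta>. (\<forall>t\<in>{a..b}. 0 < \<delta> t) \<and> (\<forall>k s \<tau>. fine_tagged_partition \<delta> a b k s \<tau> \<longrightarrow>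
           norm ((\<Sum>i<k. (g (s (Suc i)) - g (s i)) *\<^sub>R f (\<tau> i)) - I) < e)"
      using \<delta> unfolding ks_sum_def by blast
  qed
qed

lemma has_ks_integral_ks_integral:
  fixes f :: "real \<Rightarrow> 'a::euclidean_space"
  assumes N: "is_norm N" and int: "ks_integrable N f g a b" and "a \<le> b"
  shows "has_ks_integral norm f g a b (ks_integral N f g a b)"
proof -
  obtain I where I: "has_ks_integral N f g a b I" using int by (auto simp: ks_integrable_def)
  have "I' = I" if "has_ks_integral N f g a b I'" for I'
    using has_ks_integral_unique[OF has_ks_integral_norm[OF N I] has_ks_integral_norm[OF N that]] assms(3) .
  then have "ks_integral N f g a b = I" unfolding ks_integral_def using I by blast
  then show ?thesis using has_ks_integral_norm[OF N I] by simp
qed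

text \<open>The increment estimate for an indefinite integral, stated for both orders of \<open>s\<close> and \<open>t\<close> so
that left and right limits can be treated together.\<close>

definition ks_primitive :: "(real \<Rightarrow> 'a::real_normed_vector) \<Rightarrow> (real \<Rightarrow> 'a) \<Rightarrow> (real \<Rightarrow> real) \<Rightarrow> real set \<Rightarrow> bool" where
  "ks_primitive F f g J \<longleftrightarrow>
     (\<forall>s\<in>J. \<forall>t\<in>J. \<forall>v e. (\<forall>r\<in>closed_segment s t. norm (f r - v) \<le> e) \<longrightarrow>
        norm (F t - F s - (g t - g s) *\<^sub>R v) \<le> e * \<bar>g t - g s\<bar>)"

lemma ks_primitive_subset: "ks_primitive F f g J \<Longrightarrow> S \<subseteq> J \<Longrightarrow> ks_primitive F f g S"
  unfolding ks_primitive_def by blast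

lemma ks_primitive_ks_integral:
  fixes f :: "real \<Rightarrow> 'a::euclidean_space"
  assumes N: "is_norm N" and g: "mono_on {a..b} g"
    and int: "\<And>t. t \<in> {a..b} \<Longrightarrow> ks_integrable N f g a t"
  shows "ks_primitive (\<lambda>t. ks_integral N f g a t) f g {a..b}"
proof -
  let ?F = "\<lambda>t. ks_integral N f g a t"
  have incr: "norm (?F d - ?F c - (g d - g c) *\<^sub>R v) \<le> e * \<bar>g d - g c\<bar>"
    if "c \<in> {a..b}" "d \<in> {a..b}" "c \<le> d" "\<And>r. r \<in> {c..d} \<Longrightarrow> norm (f r - v) \<le> e" for c d v e
  proof -
    have "mono_on {c..d} g" using g that by (auto intro: mono_on_subset)
    moreover have "\<bar>g d - g c\<bar> = g d - g c" using g that by (auto simp: mono_on_def)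
    ultimately show ?thesis
      using has_ks_integral_increment[OF has_ks_integral_ks_integral[OF N int] has_ks_integral_ks_integral[OF N int], of c d v e] that
      by auto
  qed
  show ?thesis
    unfolding ks_primitive_def
  proof (intro ballI allI impI)
    fix s t v e
    assume st: "s \<in> {a..b}" "t \<in> {a..b}" and close: "\<forall>r\<in>closed_segment s t. norm (f r - v) \<le> e"
    show "norm (?F t - ?F s - (g t - g s) *\<^sub>R v) \<le> e * \<bar>g t - g s\<bar>"
    proof (cases "s \<le> t")
      case True
      then show ?thesis using incr[OF st True, of v e] close by (auto simp: closed_segment_eq_real_ivl)
    next
      case False
      have "?F t - ?F s - (g t - g s) *\<^sub>R v = - (?F s - ?F t - (g s - g t) *\<^sub>R v)"
        by (simp add: algebra_simps)
      then have "norm (?F t - ?F s - (g t - g s) *\<^sub>R v) = norm (?F s - ?F t - (g s - g t) *\<^sub>R v)"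
        by (metis norm_minus_cancel)
      then show ?thesis
        using incr[OF st(2,1), of v e] close False by (auto simp: closed_segment_eq_real_ivl abs_minus_commute)
    qed
  qed
qed

lemma ks_primitive_increment_close:
  assumes F: "ks_primitive F f g S" and S: "convex S" "t \<in> S" 
    and close: "norm (f t - v) \<le> e" "\<forall>\<^sub>F s in at t within S. norm (f s - v) \<le> e"
  shows "\<forall>\<^sub>F s in at t within S. norm (F s - F t - (g s - g t) *\<^sub>R v) \<le> e * \<bar>g s - g t\<bar>"
proof -
  obtain d where d: "0 < d" "\<And>s. s \<in> S \<Longrightarrow> s \<noteq> t \<Longrightarrow> dist s t < d \<Longrightarrow> norm (f s - v) \<le> e"
    using close(2) unfolding eventually_at by auto
  have "norm (F s - F t - (g s - g t) *\<^sub>R v) \<le> e * \<bar>g s - g t\<bar>" if "s \<in> S" "dist s t < d" for s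
  proof -
    have "norm (f r - v) \<le> e" if r: "r \<in> closed_segment t s" for r
    proof -
      have "r \<in> S" using S \<open>s \<in> S\<close> r by (meson closed_segment_subset subsetD)
      moreover have "dist r t < d"
        using r \<open>dist s t < d\<close> by (auto simp: closed_segment_eq_real_ivl dist_real_def split: if_splits)
      ultimately show ?thesis using d(2) close(1) by blast
    qed
    then show ?thesis using F S(2) \<open>s \<in> S\<close> unfolding ks_primitive_def by blast
  qed
  then show ?thesis unfolding eventually_at using d(1) by blast
qed

text \<open>The integrand is near \<open>l\<close> close to \<open>t\<close> but may take another value at \<open>t\<close>; being bounded near
\<open>t\<close> is enough for the increments of \<open>F\<close> to be dominated by those of \<open>g\<close>.\<close>

lemma ks_primitive_tendsto:
  assumes F: "ks_primitive F f g S" and S: "convex S" "t \<in> S"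
    and g: "(g \<longlongrightarrow> g t) (at t within S)" and f: "(f \<longlongrightarrow> l) (at t within S)"
  shows "(F \<longlongrightarrow> F t) (at t within S)"
proof -
  define K where "K = norm (l - f t) + 1"
  have "\<forall>\<^sub>F s in at t within S. norm (f s - f t) < K"
    using f by (intro order_tendstoD(2)[of "\<lambda>s. norm (f s - f t)" "norm (l - f t)"] tendsto_intros)
      (auto simp: K_def)
  then have "\<forall>\<^sub>F s in at t within S. norm (f s - f t) \<le> K" by (rule eventually_mono) simp
  then have "\<forall>\<^sub>F s in at t within S. norm (F s - F t - (g s - g t) *\<^sub>R f t) \<le> K * \<bar>g s - g t\<bar>"
    by (intro ks_primitive_increment_close[OF F S]) (auto simp: K_def)
  moreover have "((\<lambda>s. K * \<bar>g s - g t\<bar>) \<longlongrightarrow> K * \<bar>g t - g t\<bar>) (at t within S)"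
    by (intro tendsto_intros g)
  ultimately have "((\<lambda>s. F s - F t - (g s - g t) *\<^sub>R f t) \<longlongrightarrow> 0) (at t within S)"
    using Lim_null_comparison by simp
  moreover have "((\<lambda>s. F t + (g s - g t) *\<^sub>R f t) \<longlongrightarrow> F t + (g t - g t) *\<^sub>R f t) (at t within S)"
    by (intro tendsto_intros g)
  ultimately have "((\<lambda>s. (F s - F t - (g s - g t) *\<^sub>R f t) + (F t + (g s - g t) *\<^sub>R f t)) \<longlongrightarrow> 0 + F t) (at t within S)"
    by (intro tendsto_add) auto
  then show ?thesis by simp
qed

lemma has_vector_derivative_quotient:
  "(F has_vector_derivative D) (at t within S) \<longleftrightarrow>
     ((\<lambda>s. (F s - F t) /\<^sub>R (s - t)) \<longlongrightarrow> D) (at t within S)"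
proof -
  have "norm ((1 / norm (s - t)) *\<^sub>R (F s - (F t + (s - t) *\<^sub>R D))) = norm ((F s - F t) /\<^sub>R (s - t) - D)"
    if "s \<noteq> t" for s
  proof -
    have "(F s - F t) /\<^sub>R (s - t) - D
        = (1 / (s - t)) *\<^sub>R (F s - F t) - (1 / (s - t)) *\<^sub>R ((s - t) *\<^sub>R D)"
      using that by (simp add: divide_inverse)
    also have "\<dots> = (1 / (s - t)) *\<^sub>R (F s - (F t + (s - t) *\<^sub>R D))"
      by (simp only: scaleR_diff_right[symmetric] diff_diff_eq)
    finally have "(F s - F t) /\<^sub>R (s - t) - D = (1 / (s - t)) *\<^sub>R (F s - (F t + (s - t) *\<^sub>R D))" .
    then show ?thesis by simp
  qed
  then have "((\<lambda>s. (1 / norm (s - t)) *\<^sub>R (F s - (F t + (s - t) *\<^sub>R D))) \<longlongrightarrow> 0) (at t within S)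
     \<longleftrightarrow> ((\<lambda>s. (F s - F t) /\<^sub>R (s - t) - D) \<longlongrightarrow> 0) (at t within S)"
    by (subst (1 2) tendsto_norm_zero_iff[symmetric])
      (intro tendsto_cong, simp add: eventually_at_filter)
  then show ?thesis
    unfolding has_vector_derivative_def has_derivative_within
    by (simp add: bounded_linear_scaleR_left LIM_zero_iff)
qed

text \<open>The fundamental theorem of calculus for Stieltjes integrals: close to \<open>t\<close> the increment of \<open>F\<close> differs
from \<open>(g s - g t) f t\<close> by an arbitrarily small multiple of \<open>g s - g t\<close>, which is of order
\<open>s - t\<close>.\<close>

lemma ks_primitive_has_vector_derivative:
  assumes F: "ks_primitive F f g S" and S: "convex S" "t \<in> S"
    and g: "(g has_real_derivative D) (at t within S)" and f: "(f \<longlongrightarrow> f t) (at t within S)"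
  shows "(F has_vector_derivative D *\<^sub>R f t) (at t within S)"
  unfolding has_vector_derivative_quotient
proof -
  have g': "((\<lambda>s. (g s - g t) /\<^sub>R (s - t)) \<longlongrightarrow> D) (at t within S)"
    using g by (simp add: has_real_derivative_iff_has_vector_derivative has_vector_derivative_quotient)
  define r where "r s = (F s - F t - (g s - g t) *\<^sub>R f t) /\<^sub>R (s - t)" for s
  have "(r \<longlongrightarrow> 0) (at t within S)"
    unfolding tendsto_iff
  proof (intro allI impI)
    fix e :: real assume "0 < e"
    \<comment> \<open>Difference quotients of \<open>g\<close> are eventually below \<open>\<bar>D\<bar> + 1\<close>, so this \<open>\<epsilon>\<close> makes the error smaller than \<open>e\<close>.\<close>
    define \<epsilon> where "\<epsilon> = e / (\<bar>D\<bar> + 1)"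
    have "0 < \<epsilon>" using \<open>0 < e\<close> by (simp add: \<epsilon>_def)
    have "\<forall>\<^sub>F s in at t within S. norm (f s - f t) < \<epsilon>"
      using f \<open>0 < \<epsilon>\<close> by (simp add: tendsto_iff dist_norm)
    then have "\<forall>\<^sub>F s in at t within S. norm (f s - f t) \<le> \<epsilon>" by (rule eventually_mono) simp
    then have "\<forall>\<^sub>F s in at t within S. norm (F s - F t - (g s - g t) *\<^sub>R f t) \<le> \<epsilon> * \<bar>g s - g t\<bar>"
      using \<open>0 < \<epsilon>\<close> by (intro ks_primitive_increment_close[OF F S]) auto
    moreover have "\<forall>\<^sub>F s in at t within S. \<bar>(g s - g t) /\<^sub>R (s - t)\<bar> < \<bar>D\<bar> + 1"
      using g' by (intro order_tendstoD(2)[OF tendsto_rabs]) auto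
    moreover have "\<forall>\<^sub>F s in at t within S. s \<noteq> t" by (simp add: eventually_at_filter)
    ultimately show "\<forall>\<^sub>F s in at t within S. dist (r s) 0 < e"
    proof eventually_elim
      case (elim s)
      have "norm (r s) = norm (F s - F t - (g s - g t) *\<^sub>R f t) / \<bar>s - t\<bar>"
        by (simp add: r_def divide_inverse mult.commute)
      also have "\<dots> \<le> \<epsilon> * \<bar>g s - g t\<bar> / \<bar>s - t\<bar>"
        using elim by (intro divide_right_mono) auto
      also have "\<dots> = \<epsilon> * \<bar>(g s - g t) /\<^sub>R (s - t)\<bar>"
        by (simp add: divide_inverse abs_mult)
      also have "\<dots> < \<epsilon> * (\<bar>D\<bar> + 1)"
        using elim \<open>0 < \<epsilon>\<close> by (intro mult_strict_left_mono) auto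
      also have "\<dots> = e" by (simp add: \<epsilon>_def add_nonneg_eq_0_iff)
      finally show ?case by simp
    qed
  qed
  moreover have "((\<lambda>s. ((g s - g t) /\<^sub>R (s - t)) *\<^sub>R f t) \<longlongrightarrow> D *\<^sub>R f t) (at t within S)"
    by (intro tendsto_intros g')
  ultimately have "((\<lambda>s. r s + ((g s - g t) /\<^sub>R (s - t)) *\<^sub>R f t) \<longlongrightarrow> 0 + D *\<^sub>R f t) (at t within S)"
    by (rule tendsto_add)
  moreover have "r s + ((g s - g t) /\<^sub>R (s - t)) *\<^sub>R f t = (F s - F t) /\<^sub>R (s - t)" for s
    by (simp add: r_def algebra_simps)
  ultimately show "((\<lambda>s. (F s - F t) /\<^sub>R (s - t)) \<longlongrightarrow> D *\<^sub>R f t) (at t within S)" by simp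
qed

section \<open>Differentiating an implicit equation\<close>

text \<open>The error \<open>r\<close> is allowed to be as large as a small multiple of the unknown \<open>q\<close>. Applying the left
inverse \<open>B'\<close> bounds \<open>q\<close> by \<open>B' w\<close> plus at most half of \<open>1 + norm q\<close>, so \<open>q\<close> is bounded,
and then the error tends to zero.\<close>

lemma tendsto_perturbed_linear_equation:
  fixes q :: "'b \<Rightarrow> 'a::real_normed_vector"
  assumes B': "bounded_linear B'" and inv: "\<And>u. B' (B u) = u"
    and eq: "\<forall>\<^sub>F s in F. B (q s) = w s + r s"
    and w: "(w \<longlongrightarrow> w0) F"
    and r: "\<forall>\<^sub>F s in F. norm (r s) \<le> e s * (1 + norm (q s))" and e: "(e \<longlongrightarrow> 0) F"
  shows "(q \<longlongrightarrow> B' w0) F"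
proof -
  interpret B': bounded_linear B' by (rule B')
  obtain K where K: "0 < K" "\<And>u. norm (B' u) \<le> norm u * K" using B'.pos_bounded by blast
  have Bw: "((\<lambda>s. B' (w s)) \<longlongrightarrow> B' w0) F" by (rule B'.tendsto[OF w])
  have "\<forall>\<^sub>F s in F. e s < 1 / (2 * K)" using e K(1) by (intro order_tendstoD(2)[OF e]) simp
  with eq r have "\<forall>\<^sub>F s in F. norm (q s - B' (w s)) \<le> \<bar>e s\<bar> * (K * (2 + 2 * norm (B' (w s))))"
  proof eventually_elim
    case (elim s)
    have split: "q s - B' (w s) = B' (r s)" using inv[of "q s"] unfolding elim(1) B'.add
      by (metis add_diff_cancel_left')
    have "norm (B' (r s)) \<le> norm (r s) * K" by (rule K)
    also have "\<dots> \<le> e s * (1 + norm (q s)) * K" using elim(2) K(1) by (intro mult_right_mono) auto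
    finally have 1: "norm (B' (r s)) \<le> (e s * K) * (1 + norm (q s))" by (simp add: mult_ac)
    have "e s * K \<le> 1 / 2" using elim(3) K(1) by (simp add: field_simps)
    then have "(e s * K) * (1 + norm (q s)) \<le> 1 / 2 * (1 + norm (q s))" by (intro mult_right_mono) auto
    moreover have "norm (q s) \<le> norm (B' (w s)) + norm (B' (r s))"
      using norm_triangle_ineq[of "B' (w s)" "B' (r s)"] split by (simp add: algebra_simps)
    ultimately have "norm (q s) \<le> 1 + 2 * norm (B' (w s))" using 1 by argo
    then have "(e s * K) * (1 + norm (q s)) \<le> (\<bar>e s\<bar> * K) * (2 + 2 * norm (B' (w s)))"
      using K(1) by (intro mult_mono) (auto intro: mult_right_mono)
    with 1 show ?case unfolding split by (simp add: mult.assoc)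
  qed
  moreover have "((\<lambda>s. \<bar>e s\<bar> * (K * (2 + 2 * norm (B' (w s))))) \<longlongrightarrow> \<bar>0\<bar> * (K * (2 + 2 * norm (B' w0)))) F"
    by (intro tendsto_intros e Bw)
  ultimately have "((\<lambda>s. q s - B' (w s)) \<longlongrightarrow> 0) F" using Lim_null_comparison by simp
  from tendsto_add[OF this Bw] show ?thesis by simp
qed

lemma partial_derivative_jacobian:
  fixes h :: "real \<Rightarrow> real^'n \<Rightarrow> real^'n"
  assumes "((\<lambda>(t, u). h t u) has_derivative T) (at (t, v) within J \<times> UNIV)" and "t \<in> J"
  shows "T (0, u) = jacobian (h t) (at v) *v u"
proof -
  have "((\<lambda>u. (t, u)) has_derivative (\<lambda>u. (0, u))) (at v)"
    by (intro derivative_eq_intros) auto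
  moreover have "((\<lambda>(t, u). h t u) has_derivative T) (at (t, v) within range (\<lambda>u. (t, u)))"
    using assms by (intro has_derivative_subset[OF assms(1)]) auto
  ultimately have "((\<lambda>u. (\<lambda>(t, u). h t u) (t, u)) has_derivative (\<lambda>u. T (0, u))) (at v)"
    by (rule has_derivative_in_compose)
  then have der: "(h t has_derivative (\<lambda>u. T (0, u))) (at v)" by simp
  then have "h t differentiable (at v)" unfolding differentiable_def by blast
  then have "(h t has_derivative (\<lambda>u. jacobian (h t) (at v) *v u)) (at v)"
    by (rule jacobian_works[THEN iffD1])
  from has_derivative_unique[OF der this] show ?thesis by metis
qed

lemma invertible_id_minus:
  fixes M :: "real^'n^'n"
  assumes "invertible (mat 1 - M)" and "\<And>u. A u = M *v u"
  obtains R where "bounded_linear R" "\<And>u. R (u - A u) = u" "\<And>u. R u - A (R u) = u"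
proof -
  obtain M' where M': "(mat 1 - M) ** M' = mat 1" "M' ** (mat 1 - M) = mat 1"
    using assms(1) unfolding invertible_def by blast
  have A: "u - A u = (mat 1 - M) *v u" for u
    by (simp add: assms(2) matrix_vector_mult_diff_rdistrib)
  show ?thesis
  proof (rule that)
    show "bounded_linear (\<lambda>u. M' *v u)" by (rule matrix_vector_mul_bounded_linear)
    show "M' *v (u - A u) = u" "M' *v u - A (M' *v u) = u" for u
      unfolding A matrix_vector_mul_assoc M' by simp_all
  qed
qed

text \<open>Dividing the increment of the implicit equation by \<open>s - t\<close> gives a linear equation for the difference
quotient \<open>q\<close> of \<open>x\<close>. The remainder of the linearisation of \<open>h\<close> is small compared with
\<open>\<bar>s - t\<bar> + norm (x s - x t)\<close>, that is, with \<open>\<bar>s - t\<bar> * (1 + norm q)\<close>, which is the kind of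
error that \<open>tendsto_perturbed_linear_equation\<close> tolerates.\<close>

lemma implicit_derivative_within:
  fixes h :: "real \<Rightarrow> real^'n \<Rightarrow> real^'n"
  assumes h: "((\<lambda>(t, u). h t u) has_derivative T) (at (t, x t) within J \<times> UNIV)"
    and inv: "invertible (mat 1 - jacobian (h t) (at (x t)))"
    and S: "S \<subseteq> J" "t \<in> S"
    and eq: "\<And>s. s \<in> S \<Longrightarrow> x s - h s (x s) = C + F s"
    and x: "(x \<longlongrightarrow> x t) (at t within S)"
    and F: "(F has_vector_derivative D) (at t within S)"
  shows "\<exists>x'. (x has_vector_derivative x') (at t within S) \<and> x' - T (0, x') = T (1, 0) + D"
proof -
  interpret T: bounded_linear T using h by (rule has_derivative_bounded_linear)
  obtain R where R: "bounded_linear R" "\<And>u. R (u - T (0, u)) = u" "\<And>u. R u - T (0, R u) = u"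
    using invertible_id_minus[OF inv, of "\<lambda>u. T (0, u)"] partial_derivative_jacobian[OF h] S by blast
  define p where "p s = (s, x s)" for s
  \<comment> \<open>The remainder of the linearisation, divided by the distance to the base point.\<close>
  define \<rho> where "\<rho> y = (1 / norm (y - p t)) *\<^sub>R
      ((\<lambda>(t, u). h t u) y - ((\<lambda>(t, u). h t u) (p t) + T (y - p t)))" for y
  have near: "\<forall>\<^sub>F s in at t within S. s \<in> S \<and> s \<noteq> t" by (simp add: eventually_at_filter)
  have "(\<rho> \<longlongrightarrow> 0) (at (p t) within J \<times> UNIV)"
    using h unfolding has_derivative_within \<rho>_def p_def by blast
  moreover have "filterlim p (at (p t) within J \<times> UNIV) (at t within S)"
    unfolding filterlim_at
  proof
    show "\<forall>\<^sub>F s in at t within S. p s \<in> J \<times> UNIV \<and> p s \<noteq> p t"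
      using near by (rule eventually_mono) (use S in \<open>auto simp: p_def\<close>)
    show "(p \<longlongrightarrow> p t) (at t within S)"
      unfolding p_def by (intro tendsto_intros x)
  qed
  ultimately have \<rho>: "((\<lambda>s. \<rho> (p s)) \<longlongrightarrow> 0) (at t within S)" by (rule filterlim_compose)
  define q where "q s = (x s - x t) /\<^sub>R (s - t)" for s
  define r where "r s = (norm (p s - p t) / (s - t)) *\<^sub>R \<rho> (p s)" for s
  have eq': "q s - T (0, q s) = (T (1, 0) + (F s - F t) /\<^sub>R (s - t)) + r s" if s: "s \<in> S" "s \<noteq> t" for s
  proof -
    have "p s \<noteq> p t" using s by (simp add: p_def)
    then have "norm (p s - p t) *\<^sub>R \<rho> (p s) =
        (\<lambda>(t, u). h t u) (p s) - ((\<lambda>(t, u). h t u) (p t) + T (p s - p t))"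
      by (simp add: \<rho>_def)
    moreover have "(\<lambda>(t, u). h t u) (p s) = h s (x s)" "(\<lambda>(t, u). h t u) (p t) = h t (x t)"
      by (simp_all add: p_def)
    ultimately have h_eq: "h s (x s) - h t (x t) = T (p s - p t) + norm (p s - p t) *\<^sub>R \<rho> (p s)"
      by simp
    have "p s - p t = (s - t) *\<^sub>R (1, 0) + (0, x s - x t)" by (simp add: p_def)
    then have T_eq: "T (p s - p t) = (s - t) *\<^sub>R T (1, 0) + T (0, x s - x t)"
      by (simp only: T.add T.scaleR)
    have F_eq: "F s - F t = (x s - h s (x s)) - (x t - h t (x t))"
      by (simp add: eq[OF s(1)] eq[OF S(2)])
    have "x s - x t = (h s (x s) - h t (x t)) + (F s - F t)"
      unfolding F_eq by simp
    then have "(x s - x t) - T (0, x s - x t) = (s - t) *\<^sub>R T (1, 0) + norm (p s - p t) *\<^sub>R \<rho> (p s) + (F s - F t)"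
      unfolding h_eq T_eq by (simp add: algebra_simps)
    then have "((x s - x t) - T (0, x s - x t)) /\<^sub>R (s - t)
        = ((s - t) *\<^sub>R T (1, 0) + norm (p s - p t) *\<^sub>R \<rho> (p s) + (F s - F t)) /\<^sub>R (s - t)" by simp
    moreover have "T (0, q s) = T (0, x s - x t) /\<^sub>R (s - t)"
      using T.scaleR[of "inverse (s - t)" "(0, x s - x t)"] by (simp add: q_def)
    ultimately show ?thesis
      using s(2) by (simp add: q_def r_def scaleR_diff_right scaleR_add_right divide_inverse mult.commute)
  qed
  have bound: "norm (r s) \<le> norm (\<rho> (p s)) * (1 + norm (q s))" if s: "s \<in> S" "s \<noteq> t" for s
  proof -
    have "norm (p s - p t) \<le> \<bar>s - t\<bar> + norm (x s - x t)"
      unfolding p_def using norm_Pair_le[of "s - t" "x s - x t"] by simp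
    then have "norm (p s - p t) / \<bar>s - t\<bar> \<le> (\<bar>s - t\<bar> + norm (x s - x t)) / \<bar>s - t\<bar>"
      by (rule divide_right_mono) simp
    also have "norm (x s - x t) = norm (q s) * \<bar>s - t\<bar>"
      using s(2) by (simp add: q_def)
    also have "(\<bar>s - t\<bar> + norm (q s) * \<bar>s - t\<bar>) / \<bar>s - t\<bar> = 1 + norm (q s)"
      using s(2) by (simp add: add_divide_distrib)
    finally have "norm (p s - p t) / \<bar>s - t\<bar> * norm (\<rho> (p s)) \<le> (1 + norm (q s)) * norm (\<rho> (p s))"
      by (rule mult_right_mono) simp
    then show ?thesis by (simp add: r_def mult.commute)
  qed
  have "(q \<longlongrightarrow> R (T (1, 0) + D)) (at t within S)"
  proof (rule tendsto_perturbed_linear_equation[OF R(1)])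
    show "R (u - T (0, u)) = u" for u by (rule R)
    show "\<forall>\<^sub>F s in at t within S. q s - T (0, q s) = (T (1, 0) + (F s - F t) /\<^sub>R (s - t)) + r s"
      using near by (rule eventually_mono) (use eq' in blast)
    show "\<forall>\<^sub>F s in at t within S. norm (r s) \<le> norm (\<rho> (p s)) * (1 + norm (q s))"
      using near by (rule eventually_mono) (use bound in blast)
    show "((\<lambda>s. T (1, 0) + (F s - F t) /\<^sub>R (s - t)) \<longlongrightarrow> T (1, 0) + D) (at t within S)"
      using F unfolding has_vector_derivative_quotient by (intro tendsto_intros)
    show "((\<lambda>s. norm (\<rho> (p s))) \<longlongrightarrow> 0) (at t within S)" using \<rho> by (rule tendsto_norm_zero)
  qed
  then have "(x has_vector_derivative R (T (1, 0) + D)) (at t within S)"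
    unfolding has_vector_derivative_quotient q_def .
  then show ?thesis using R(3) by blast
qed

section \<open>Continuity of solutions\<close>

text \<open>Passing to the limit in the equation shows that \<open>l\<close> and \<open>x t\<close> are mapped to the same point by
\<open>u \<mapsto> u - h t u\<close>, which is injective by the strict contraction property.\<close>

lemma solution_one_sided_limit:
  fixes h f :: "real \<Rightarrow> 'a::euclidean_space \<Rightarrow> 'a" and N :: "'a \<Rightarrow> real"
  assumes strict: "\<And>u v. u \<noteq> v \<Longrightarrow> N (h t u - h t v) < N (u - v)"
    and h: "continuous_on (J \<times> UNIV) (\<lambda>(t, u). h t u)"
    and f: "continuous_on (J \<times> UNIV) (\<lambda>(t, u). f t u)"
    and g: "continuous_on J g" and F: "ks_primitive F (\<lambda>s. f s (x s)) g J"
    and eq: "\<And>s. s \<in> J \<Longrightarrow> x s - h s (x s) = C + F s"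
    and S: "convex S" "S \<subseteq> J" "t \<in> S" and nontriv: "at t within S \<noteq> bot"
    and l: "(x \<longlongrightarrow> l) (at t within S)"
  shows "l = x t"
proof -
  have near: "\<forall>\<^sub>F s in at t within S. s \<in> S" by (simp add: eventually_at_filter)
  have pair: "((\<lambda>s. (s, x s)) \<longlongrightarrow> (t, l)) (at t within S)" by (intro tendsto_intros l)
  have inJ: "\<forall>\<^sub>F s in at t within S. (s, x s) \<in> J \<times> UNIV"
    using near by (rule eventually_mono) (use S in auto)
  have tl: "(t, l) \<in> J \<times> UNIV" using S by auto
  have f_lim: "((\<lambda>s. f s (x s)) \<longlongrightarrow> f t l) (at t within S)"
    using continuous_on_tendsto_compose[OF f pair tl inJ] by simp
  have h_lim: "((\<lambda>s. h s (x s)) \<longlongrightarrow> h t l) (at t within S)"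
    using continuous_on_tendsto_compose[OF h pair tl inJ] by simp
  have "(g \<longlongrightarrow> g t) (at t within S)"
    using continuous_on_subset[OF g S(2)] S(3) by (simp add: continuous_on_def)
  then have "(F \<longlongrightarrow> F t) (at t within S)"
    using ks_primitive_tendsto[OF ks_primitive_subset[OF F S(2)] S(1,3) _ f_lim] by blast
  then have "((\<lambda>s. C + F s) \<longlongrightarrow> C + F t) (at t within S)" by (intro tendsto_intros)
  moreover have "\<forall>\<^sub>F s in at t within S. x s - h s (x s) = C + F s"
    using near by (rule eventually_mono) (use S eq in auto)
  ultimately have "((\<lambda>s. x s - h s (x s)) \<longlongrightarrow> C + F t) (at t within S)"
    by (simp add: tendsto_cong)
  moreover have "((\<lambda>s. x s - h s (x s)) \<longlongrightarrow> l - h t l) (at t within S)"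
    by (intro tendsto_intros l h_lim)
  ultimately have "l - h t l = x t - h t (x t)"
    using tendsto_unique[OF nontriv] eq S by (metis subsetD)
  then have "l - x t = h t l - h t (x t)" by (simp add: algebra_simps)
  then show ?thesis using strict[of l "x t"] by (metis less_irrefl)
qed

lemma solution_continuous:
  fixes h f :: "real \<Rightarrow> 'a::euclidean_space \<Rightarrow> 'a" and N :: "'a \<Rightarrow> real"
  assumes strict: "\<And>t u v. t \<in> {a..b} \<Longrightarrow> u \<noteq> v \<Longrightarrow> N (h t u - h t v) < N (u - v)"
    and h: "continuous_on ({a..b} \<times> UNIV) (\<lambda>(t, u). h t u)"
    and f: "continuous_on ({a..b} \<times> UNIV) (\<lambda>(t, u). f t u)"
    and g: "continuous_on {a..b} g" and F: "ks_primitive F (\<lambda>s. f s (x s)) g {a..b}"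
    and eq: "\<And>s. s \<in> {a..b} \<Longrightarrow> x s - h s (x s) = C + F s"
    and reg: "regulated_on a b x"
  shows "continuous_on {a..b} x"
  unfolding continuous_on_def
proof
  fix t assume t: "t \<in> {a..b}"
  note limit = solution_one_sided_limit[OF strict[OF t] h f g F eq]
  have left: "(x \<longlongrightarrow> x t) (at t within {a..t})"
  proof (cases "a < t")
    case True
    then have at: "at t within {a..t} = at_left t" by (rule at_within_Icc_at_left)
    have "t \<in> {a<..b}" using t True by auto
    then obtain l where "(x \<longlongrightarrow> l) (at t within {a..t})"
      using reg unfolding at regulated_on_def by blast
    then show ?thesis using limit[of "{a..t}" l] t at by auto
  qed (use t in \<open>auto simp: tendsto_def eventually_at intro: zero_less_one\<close>)
  have right: "(x \<longlongrightarrow> x t) (at t within {t..b})"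
  proof (cases "t < b")
    case True
    then have at: "at t within {t..b} = at_right t" by (rule at_within_Icc_at_right)
    have "t \<in> {a..<b}" using t True by auto
    then obtain l where "(x \<longlongrightarrow> l) (at t within {t..b})"
      using reg unfolding at regulated_on_def by blast
    then show ?thesis using limit[of "{t..b}" l] t at by auto
  qed (use t in \<open>auto simp: tendsto_def eventually_at intro: zero_less_one\<close>)
  have "{a..b} = {a..t} \<union> {t..b}" using t by auto
  then show "(x \<longlongrightarrow> x t) (at t within {a..b})"
    using left right by (simp add: Lim_within_Un)
qed

text \<open>The coefficients of the linear equation for \<open>y\<close> converge as \<open>s\<close> tends to \<open>t\<close>; replacing \<open>T s\<close>
by \<open>T t\<close> on the left costs an error of at most \<open>norm (T s - T t) * norm (y s)\<close>.\<close>

lemma implicit_derivative_continuous: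
  fixes T :: "real \<Rightarrow> (real \<times> (real^'n)) \<Rightarrow>\<^sub>L (real^'n)"
  assumes inv: "invertible (mat 1 - M)" "\<And>u. T t (0, u) = M *v u"
    and T: "(T \<longlongrightarrow> T t) (at t within S)"
    and y: "\<And>s. s \<in> S \<inter> ball t d \<Longrightarrow> y s - T s (0, y s) = T s (1, 0) + w s"
    and w: "(w \<longlongrightarrow> w t) (at t within S)" and "t \<in> S" "0 < d"
  shows "continuous (at t within S) y"
proof -
  obtain R where R: "bounded_linear R" "\<And>u. R (u - T t (0, u)) = u" "\<And>u. R u - T t (0, R u) = u"
    by (rule invertible_id_minus[OF inv]) blast
  have near: "\<forall>\<^sub>F s in at t within S. s \<in> S \<inter> ball t d"
    unfolding eventually_at using \<open>0 < d\<close> by (auto simp: dist_commute)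
  have "(y \<longlongrightarrow> R (T t (1, 0) + w t)) (at t within S)"
  proof (rule tendsto_perturbed_linear_equation[OF R(1,2)])
    show "\<forall>\<^sub>F s in at t within S. y s - T t (0, y s) = (T s (1, 0) + w s) + (T s - T t) (0, y s)"
      using near
    proof eventually_elim
      case (elim s)
      show ?case unfolding y[OF elim, symmetric] by (simp add: blinfun.diff_left)
    qed
    show "((\<lambda>s. T s (1, 0) + w s) \<longlongrightarrow> T t (1, 0) + w t) (at t within S)"
      by (intro tendsto_intros T w)
    have "norm ((T s - T t) (0, y s)) \<le> norm (T s - T t) * (1 + norm (y s))" for s
    proof -
      have "norm ((T s - T t) (0, y s)) \<le> norm (T s - T t) * norm (y s)"
        using norm_blinfun[of "T s - T t" "(0, y s)"] by (simp add: norm_Pair)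
      also have "\<dots> \<le> norm (T s - T t) * (1 + norm (y s))" by (intro mult_left_mono) auto
      finally show ?thesis .
    qed
    then show "\<forall>\<^sub>F s in at t within S. norm ((T s - T t) (0, y s)) \<le> norm (T s - T t) * (1 + norm (y s))"
      by simp
    show "((\<lambda>s. norm (T s - T t)) \<longlongrightarrow> 0) (at t within S)"
      using T by (simp add: LIM_zero tendsto_norm_zero)
  qed
  moreover have "R (T t (1, 0) + w t) = y t"
    using y[of t] R(2)[of "y t"] assms by simp
  ultimately show ?thesis by (simp add: continuous_within)
qed

section \<open>Regularity of solutions\<close>

theorem proposition4p2:
  fixes N :: "real^'n \<Rightarrow> real"
    and t0 a :: real
    and g :: "real \<Rightarrow> real"
    and x0 :: "real^'n"
    and f h :: "real \<Rightarrow> real^'n \<Rightarrow> real^'n"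
    and x :: "real \<Rightarrow> real^'n"
  assumes norm_N: "is_norm N"
    and a_pos: "a > 0"
    and g_mono: "mono_on {t0..t0 + a} g"
    and g_left_cont: "\<forall>t\<in>{t0<..t0 + a}. continuous (at_left t) g"
    and A1: "\<forall>u. ks_integrable N (\<lambda>t. f t u) g t0 (t0 + a)"
    and A2: "\<exists>M. (\<forall>t\<in>{t0..t0 + a}. 0 \<le> M t) \<and> ks_integrable abs M g t0 (t0 + a) \<and>
        (\<forall>u c d. t0 \<le> c \<and> c \<le> d \<and> d \<le> t0 + a \<longrightarrow>
           N (ks_integral N (\<lambda>s. f s u) g c d) \<le> ks_integral abs M g c d)"
    and A3_regulated: "\<forall>v. regulated_on t0 (t0 + a) (\<lambda>t. h t v)"
    and A3_contraction: "\<exists>\<phi>. \<forall>r\<ge>0. D_function (\<lambda>s. \<phi> s r) \<and> (\<forall>s>0. \<phi> s r < s) \<and>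
        (\<forall>u v. \<forall>t\<in>{t0..t0 + a}. N u \<le> r \<and> N v \<le> r \<longrightarrow> N (h t u - h t v) \<le> \<phi> (N (u - v)) r)"
    and sol: "is_solution N f h g t0 a x0 x"
    and h_C1: "continuously_differentiable_on (\<lambda>(t, u). h t u) ({t0..t0 + a} \<times> UNIV)"
    and invertible: "\<forall>t\<in>{t0..t0 + a}. invertible (mat 1 - jacobian (h t) (at (x t)))"
    and f_cont: "continuous_on ({t0..t0 + a} \<times> UNIV) (\<lambda>(t, u). f t u)"
    and g_cont: "continuous_on {t0..t0 + a} g"
  shows "(AE t\<in>{t0..t0 + a} in lebesgue. x differentiable (at t within {t0..t0 + a})) \<and>
    (\<forall>t\<in>{t0..<t0 + a}. (\<exists>D. (g has_real_derivative D) (at_right t)) \<longrightarrow>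
        (\<exists>D. (x has_vector_derivative D) (at_right t))) \<and>
    (\<forall>t\<in>{t0<..t0 + a}. (\<exists>D. (g has_real_derivative D) (at_left t)) \<longrightarrow>
        (\<exists>D. (x has_vector_derivative D) (at_left t))) \<and>
    (\<forall>t\<in>{t0..t0 + a}. g differentiable (at t within {t0..t0 + a}) \<longrightarrow>
        x differentiable (at t within {t0..t0 + a})) \<and>
    (\<forall>t\<in>{t0..t0 + a}. continuously_differentiable_at g t {t0..t0 + a} \<longrightarrow>
        continuously_differentiable_at x t {t0..t0 + a})"
proof -
  define J where "J = {t0..t0 + a}"
  define F where "F t = ks_integral N (\<lambda>s. f s (x s)) g t0 t" for t
  define C where "C = x0 - h t0 (x t0)"
  have convex_J: "convex J" by (simp add: J_def)
  have F: "ks_primitive F (\<lambda>s. f s (x s)) g J"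
    unfolding F_def J_def using sol
    by (intro ks_primitive_ks_integral[OF norm_N g_mono]) (auto simp: is_solution_def)
  have eq: "x t - h t (x t) = C + F t" if "t \<in> J" for t
  proof -
    have "x t = x0 - h t0 (x t0) + h t (x t) + F t"
      using sol that unfolding is_solution_def F_def J_def by blast
    then show ?thesis unfolding C_def by (metis add.commute add.left_commute add_diff_cancel_left')
  qed
  obtain \<phi> where \<phi>: "\<And>s r. 0 \<le> r \<Longrightarrow> 0 < s \<Longrightarrow> \<phi> s r < s"
    "\<And>r u v t. 0 \<le> r \<Longrightarrow> t \<in> J \<Longrightarrow> N u \<le> r \<Longrightarrow> N v \<le> r \<Longrightarrow> N (h t u - h t v) \<le> \<phi> (N (u - v)) r"
    using A3_contraction unfolding J_def by blast
  \<comment> \<open>Any \<open>r\<close> bounding the norms of both points is admissible in the contraction hypothesis.\<close>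
  have strict: "N (h t u - h t v) < N (u - v)" if "t \<in> J" "u \<noteq> v" for t u v
  proof -
    have "0 \<le> max (N u) (N v)" "0 < N (u - v)"
      using norm_N \<open>u \<noteq> v\<close> unfolding is_norm_def by (auto simp: less_le le_max_iff_disj)
    then show ?thesis
      using \<phi>(1)[of "max (N u) (N v)" "N (u - v)"] \<phi>(2)[of "max (N u) (N v)" t u v] that(1) by auto
  qed
  obtain T where T: "\<And>p. p \<in> J \<times> UNIV \<Longrightarrow>
      ((\<lambda>(t, u). h t u) has_derivative blinfun_apply (T p)) (at p within J \<times> UNIV)"
    and T_cont: "continuous_on (J \<times> UNIV) T"
    using h_C1 unfolding continuously_differentiable_on_def J_def by blast
  have h_cont: "continuous_on (J \<times> UNIV) (\<lambda>(t, u). h t u)"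
    by (rule has_derivative_continuous_on[OF T])
  have x_cont: "continuous_on J x"
    unfolding J_def
    by (rule solution_continuous[where N = N, OF _ _ f_cont g_cont F[unfolded J_def]])
      (use strict h_cont eq sol in \<open>auto simp: J_def is_solution_def\<close>)
  have pair_cont: "continuous_on J (\<lambda>s. (s, x s))" by (intro continuous_intros x_cont)
  have fx_cont: "continuous_on J (\<lambda>s. f s (x s))"
    using continuous_on_compose2[OF f_cont pair_cont] by (auto simp: J_def)
  have Tx_cont: "continuous_on J (\<lambda>s. T (s, x s))"
    using continuous_on_compose2[OF T_cont pair_cont] by auto
  \<comment> \<open>Choosing \<open>S\<close> as \<open>[t, t0 + a]\<close>, \<open>[t0, t]\<close> or \<open>J\<close> yields right, left and two-sided derivatives.\<close>
  have main: "\<exists>x'. (x has_vector_derivative x') (at t within S) \<and>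
      x' - T (t, x t) (0, x') = T (t, x t) (1, 0) + D *\<^sub>R f t (x t)"
    if S: "convex S" "S \<subseteq> J" "t \<in> S" and g': "(g has_real_derivative D) (at t within S)" for S t D
  proof (rule implicit_derivative_within[where J = J and C = C and F = F])
    show "((\<lambda>(t, u). h t u) has_derivative blinfun_apply (T (t, x t))) (at (t, x t) within J \<times> UNIV)"
      using T S by auto
    show "(x \<longlongrightarrow> x t) (at t within S)"
      using continuous_on_subset[OF x_cont S(2)] S(3) by (simp add: continuous_on_def)
    have "((\<lambda>s. f s (x s)) \<longlongrightarrow> f t (x t)) (at t within S)"
      using continuous_on_subset[OF fx_cont S(2)] S(3) by (simp add: continuous_on_def)
    then show "(F has_vector_derivative D *\<^sub>R f t (x t)) (at t within S)"
      using ks_primitive_has_vector_derivative[OF ks_primitive_subset[OF F S(2)] S(1,3) g'] by blast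
  qed (use S eq invertible in \<open>auto simp: J_def\<close>)
  have c: "x differentiable (at t within J)" if t: "t \<in> J" "g differentiable (at t within J)" for t
  proof -
    obtain D where "(g has_real_derivative D) (at t within J)"
      using t(2) unfolding real_differentiable_def by blast
    then show ?thesis using main[OF convex_J order_refl t(1)] differentiableI_vector by blast
  qed
  have "AE t\<in>J in lebesgue. x differentiable (at t within J)"
  proof (rule AE_I')
    show "{t\<in>J. \<not> g differentiable (at t within J)} \<in> null_sets lebesgue"
      using mono_on_Icc_negligible_nondifferentiable[OF _ g_mono g_cont] a_pos
      by (simp add: negligible_iff_null_sets J_def)
  qed (use c in auto)
  moreover have "\<exists>D. (x has_vector_derivative D) (at_right t)"
    if t: "t \<in> {t0..<t0 + a}" and D: "(g has_real_derivative D) (at_right t)" for t D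
  proof -
    have at: "at t within {t..t0 + a} = at_right t" using t by (intro at_within_Icc_at_right) auto
    show ?thesis using main[of "{t..t0 + a}" t D] t D unfolding at by (auto simp: J_def)
  qed
  moreover have "\<exists>D. (x has_vector_derivative D) (at_left t)"
    if t: "t \<in> {t0<..t0 + a}" and D: "(g has_real_derivative D) (at_left t)" for t D
  proof -
    have at: "at t within {t0..t} = at_left t" using t by (intro at_within_Icc_at_left) auto
    show ?thesis using main[of "{t0..t}" t D] t D unfolding at by (auto simp: J_def)
  qed
  moreover have "continuously_differentiable_at x t J"
    if t: "t \<in> J" and g: "continuously_differentiable_at g t J" for t
  proof -
    obtain G' e where e: "0 < e" and G': "\<And>s. s \<in> J \<inter> ball t e \<Longrightarrow> (g has_real_derivative G' s) (at s within J)"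
      and G'_cont: "continuous (at t within J) G'"
      using g unfolding continuously_differentiable_at_def has_real_derivative_iff_has_vector_derivative by blast
    have "\<exists>x'. \<forall>s\<in>J \<inter> ball t e. (x has_vector_derivative x' s) (at s within J) \<and>
      x' s - T (s, x s) (0, x' s) = T (s, x s) (1, 0) + G' s *\<^sub>R f s (x s)"
      using main[OF convex_J order_refl _ G'] by (intro bchoice) blast
    then obtain x' where x': "\<And>s. s \<in> J \<inter> ball t e \<Longrightarrow> (x has_vector_derivative x' s) (at s within J)"
      "\<And>s. s \<in> J \<inter> ball t e \<Longrightarrow> x' s - T (s, x s) (0, x' s) = T (s, x s) (1, 0) + G' s *\<^sub>R f s (x s)"
      by blast
    have "continuous (at t within J) x'"
    proof (rule implicit_derivative_continuous[where T = "\<lambda>s. T (s, x s)" and w = "\<lambda>s. G' s *\<^sub>R f s (x s)"])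
      show "invertible (mat 1 - jacobian (h t) (at (x t)))" using invertible t by (simp add: J_def)
      show "T (t, x t) (0, u) = jacobian (h t) (at (x t)) *v u" for u
        using partial_derivative_jacobian[OF T] t by auto
      show "((\<lambda>s. T (s, x s)) \<longlongrightarrow> T (t, x t)) (at t within J)"
        using Tx_cont t by (simp add: continuous_on_def)
      show "((\<lambda>s. G' s *\<^sub>R f s (x s)) \<longlongrightarrow> G' t *\<^sub>R f t (x t)) (at t within J)"
        using G'_cont fx_cont t by (intro tendsto_intros) (auto simp: continuous_on_def continuous_within)
    qed (use x' t e in auto)
    then show ?thesis
      unfolding continuously_differentiable_at_def using x'(1) e by blast
  qed
  ultimately show ?thesis using c unfolding J_def by blast
qed

end
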